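(* Let $\gamma:[a,b]\to\mathbb{C}$ ($a<b$) be a simple analytic curve and $k\in\{0,1,2,\dots\}\cup\{\infty\}$. Then each of the classes $U_2(\gamma^*,k)$, $U_3(\gamma^*,k)$, $U_4(\gamma^*,k)$, $U_5(\gamma^*,k)$ is a dense $G_\delta$ subset of $C^k(\gamma^* )$.
   Context: A simple curve $\gamma:[a,b]\to\mathbb{C}$ is analytic if there are an open set $V\subset\mathbb{C}$ with $[a,b]\subset V$ and an injective holomorphic $F:V\to\mathbb{C}$ with $F|_{[a,b]}=\gamma$; fix such $V,F$. $\gamma^*=\gamma([a,b])$. Let $K(\gamma,+)=F(V\cap\{\operatorname{Im}z>0\})$, $K(\gamma,-)=F(V\cap\{\operatorname{Im}z<0\})$. $C^k(\gamma^* )$ is the space of $u:\gamma^*\to\mathbb{C}$ with $u\circ\gamma$ $k$ times continuously differentiable on $[a,b]$, with seminorms $\sup_{t\in[a,b]}|(u\circ\gamma)^{(l)}(t)|$, integers $0\le l\le k$. $U_2(\gamma^*,k)$: the $u\in C^k(\gamma^* )$ for which there are no open connected $W$ with $W\cap\gamma^*\neq\emptyset$ and continuous $\lambda:\gamma^*\cup(W\cap K(\gamma,+))\to\mathbb{C}$ holomorphic on $W\cap K(\gamma,+)$ with $\lambda=u$ on $W\cap\gamma^*$. $U_3(\gamma^*,k)$: the same with $K(\gamma,-)$. $U_4(\gamma^*,k)=U_2(\gamma^*,k)\cap U_3(\gamma^*,k)$. $U_5(\gamma^*,k)$: the $u\in C^k(\gamma^* )$ for which there exist no $z_0\in\gamma^*$,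 $r>0$ and holomorphic $f$ on the open disk $D(z_0,r)$ with $f=u$ on $D(z_0,r)\cap\gamma^*$. *)

theory Defs
  imports "HOL-Analysis.Analysis" "HOL-Library.Extended_Nat"
begin

definition analytic_curve_data ::
  "real \<Rightarrow> real \<Rightarrow> (real \<Rightarrow> complex) \<Rightarrow> complex set \<Rightarrow> (complex \<Rightarrow> complex) \<Rightarrow> bool" where
  "analytic_curve_data a b \<gamma> V F \<longleftrightarrow>
     open V \<and> complex_of_real ` {a..b} \<subseteq> V \<and> F holomorphic_on V \<and> inj_on F V \<and>
     (\<forall>t\<in>{a..b}. F (complex_of_real t) = \<gamma> t)"

definition curve_img :: "real \<Rightarrow> real \<Rightarrow> (real \<Rightarrow> complex) \<Rightarrow> complex set" where
  "curve_img a b \<gamma> = \<gamma> ` {a..b}"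

definition K_plus :: "complex set \<Rightarrow> (complex \<Rightarrow> complex) \<Rightarrow> complex set" where
  "K_plus V F = F ` (V \<inter> {z. Im z > 0})"

definition K_minus :: "complex set \<Rightarrow> (complex \<Rightarrow> complex) \<Rightarrow> complex set" where
  "K_minus V F = F ` (V \<inter> {z. Im z < 0})"

fun iter_deriv :: "real \<Rightarrow> real \<Rightarrow> nat \<Rightarrow> (real \<Rightarrow> complex) \<Rightarrow> real \<Rightarrow> complex" where
  "iter_deriv a b 0 g = g"
| "iter_deriv a b (Suc j) g = (\<lambda>t. vector_derivative (iter_deriv a b j g) (at t within {a..b}))"

definition Ck_interval :: "real \<Rightarrow> real \<Rightarrow> enat \<Rightarrow> (real \<Rightarrow> complex) \<Rightarrow> bool" where
  "Ck_interval a b k g \<longleftrightarrow>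
     (\<forall>j. enat j \<le> k \<longrightarrow> continuous_on {a..b} (iter_deriv a b j g)) \<and>
     (\<forall>j. enat j < k \<longrightarrow> (\<forall>t\<in>{a..b}.
        (iter_deriv a b j g has_vector_derivative iter_deriv a b (Suc j) g t) (at t within {a..b})))"

text \<open>C^k(gamma*): functions on gamma* (extended by 0 outside gamma*) with u o gamma in C^k[a,b].\<close>
definition Ck_curve :: "real \<Rightarrow> real \<Rightarrow> (real \<Rightarrow> complex) \<Rightarrow> enat \<Rightarrow> (complex \<Rightarrow> complex) set" where
  "Ck_curve a b \<gamma> k = {u. (\<forall>z. z \<notin> curve_img a b \<gamma> \<longrightarrow> u z = 0) \<and> Ck_interval a b k (u \<circ> \<gamma>)}"

definition ck_seminorm :: "real \<Rightarrow> real \<Rightarrow> (real \<Rightarrow> complex) \<Rightarrow> nat \<Rightarrow> (complex \<Rightarrow> complex) \<Rightarrow> real" where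
  "ck_seminorm a b \<gamma> l u = Sup ((\<lambda>t. norm (iter_deriv a b l (u \<circ> \<gamma>) t)) ` {a..b})"

definition ck_topology :: "real \<Rightarrow> real \<Rightarrow> (real \<Rightarrow> complex) \<Rightarrow> enat \<Rightarrow> (complex \<Rightarrow> complex) topology" where
  "ck_topology a b \<gamma> k = topology_generated_by
     {{v \<in> Ck_curve a b \<gamma> k. \<forall>j\<le>l. ck_seminorm a b \<gamma> j (\<lambda>z. v z - u z) < \<epsilon>}
       | u l \<epsilon>. u \<in> Ck_curve a b \<gamma> k \<and> enat l \<le> k \<and> \<epsilon> > 0}"

definition extends_holo_to :: "complex set \<Rightarrow> complex set \<Rightarrow> (complex \<Rightarrow> complex) \<Rightarrow> bool" where
  "extends_holo_to G K u \<longleftrightarrow>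
     (\<exists>W lam. open W \<and> connected W \<and> W \<inter> G \<noteq> {} \<and>
        continuous_on (G \<union> (W \<inter> K)) lam \<and> lam holomorphic_on (W \<inter> K) \<and>
        (\<forall>z\<in>W \<inter> G. lam z = u z))"

definition U2 where
  "U2 a b \<gamma> V F k = {u \<in> Ck_curve a b \<gamma> k. \<not> extends_holo_to (curve_img a b \<gamma>) (K_plus V F) u}"

definition U3 where
  "U3 a b \<gamma> V F k = {u \<in> Ck_curve a b \<gamma> k. \<not> extends_holo_to (curve_img a b \<gamma>) (K_minus V F) u}"

definition U4 where
  "U4 a b \<gamma> V F k = U2 a b \<gamma> V F k \<inter> U3 a b \<gamma> V F k"

definition U5 where
  "U5 a b \<gamma> k = {u \<in> Ck_curve a b \<gamma> k. \<not> (\<exists>z0\<in>curve_img a b \<gamma>. \<exists>r>0. \<exists>f.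
      f holomorphic_on ball z0 r \<and> (\<forall>z\<in>ball z0 r \<inter> curve_img a b \<gamma>. f z = u z))}"

definition dense_gdelta_in :: "'a topology \<Rightarrow> 'a set \<Rightarrow> bool" where
  "dense_gdelta_in X S \<longleftrightarrow> gdelta_in X S \<and> X closure_of S = topspace X"

end

theory Submission
  imports Defs "HOL-Complex_Analysis.Complex_Analysis"
begin

text \<open>
  In the coordinate \<open>F\<close> the curve is a real segment, and \<open>u\<close> fails to lie in one of the classes
  exactly when, for some rational box centred on the segment, \<open>u \<circ> \<gamma>\<close> has a bounded continuous extension to
  the corresponding half (or to the whole) of the box that is holomorphic inside.  For fixed box
  and fixed bound, a two-constants estimate shows that a uniform limit of extendable functions is
  extendable to a smaller box, so the complement of each class is a countable union of closures.

  For density, \<open>v = \<Sum>n. exp (- 2\<^sup>n) cos (4\<^sup>n t)\<close> is smooth, real and nowhere analytic, so by Schwarz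
  reflection it has no one-sided extension.  If \<open>u + x * v\<close> were extendable for all small \<open>x\<close>,
  two different values of \<open>x\<close> would share the same rational box and side, and subtracting would
  extend \<open>v\<close>.
\<close>

section \<open>Extensions to half boxes\<close>

text \<open>
  The sign \<open>s\<close> selects the upper half (\<open>s = 1\<close>), the lower half (\<open>s = -1\<close>) or, for \<open>s = 0\<close>, the whole box;
  the real segment is removed from the open box only when \<open>s \<noteq> 0\<close>.
\<close>

definition side_cbox :: "real \<Rightarrow> real \<Rightarrow> real \<Rightarrow> complex set" where
  "side_cbox s c r = {z. \<bar>Re z - c\<bar> \<le> r \<and> \<bar>Im z\<bar> \<le> r \<and> 0 \<le> s * Im z}"

definition side_box :: "real \<Rightarrow> real \<Rightarrow> real \<Rightarrow> complex set" where
  "side_box s c r = {z. \<bar>Re z - c\<bar> < r \<and> \<bar>Im z\<bar> < r \<and> (s = 0 \<or> 0 < s * Im z)}"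

text \<open>The bound \<open>M\<close> is recorded so that the two-constants estimate is uniform
  over all extensions of a fixed box and bound; this is what makes the notion survive uniform
  limits.\<close>

definition side_extension ::
  "real \<Rightarrow> (real \<Rightarrow> complex) \<Rightarrow> real \<Rightarrow> real \<Rightarrow> real \<Rightarrow> (complex \<Rightarrow> complex) \<Rightarrow> bool" where
  "side_extension s h c r M f \<longleftrightarrow>
     continuous_on (side_cbox s c r) f \<and> f holomorphic_on side_box s c r \<and>
     (\<forall>z\<in>side_cbox s c r. norm (f z) \<le> M) \<and>
     (\<forall>t. \<bar>t - c\<bar> \<le> r \<longrightarrow> f (complex_of_real t) = h t)"

lemma side_box_subset_side_cbox: "side_box s c r \<subseteq> side_cbox s c r"
  by (auto simp: side_box_def side_cbox_def)

lemma open_side_box: "open (side_box s c r)"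
proof -
  have "side_box s c r = {z. \<bar>Re z - c\<bar> < r} \<inter> {z. \<bar>Im z\<bar> < r} \<inter>
      (if s = 0 then UNIV else {z. 0 < s * Im z})"
    by (auto simp: side_box_def)
  then show ?thesis
    by (auto intro!: open_Int open_Collect_less continuous_intros)
qed

lemma closed_side_cbox: "closed (side_cbox s c r)"
proof -
  have "side_cbox s c r = {z. \<bar>Re z - c\<bar> \<le> r} \<inter> {z. \<bar>Im z\<bar> \<le> r} \<inter> {z. 0 \<le> s * Im z}"
    by (auto simp: side_cbox_def)
  then show ?thesis
    by (auto intro!: closed_Int closed_Collect_le continuous_intros)
qed

lemma side_cbox_norm_le:
  assumes "z \<in> side_cbox s c r"
  shows "norm (z - of_real c) \<le> 2 * r"
  using assms cmod_le[of "z - of_real c"] by (auto simp: side_cbox_def)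

lemma compact_side_cbox: "compact (side_cbox s c r)"
proof -
  have "side_cbox s c r \<subseteq> cball (of_real c) (2 * r)"
    using side_cbox_norm_le by (force simp: dist_norm norm_minus_commute)
  then show ?thesis
    using closed_side_cbox bounded_cball bounded_subset compact_eq_bounded_closed by blast
qed

lemma interior_side_cbox: "interior (side_cbox 1 0 r) \<subseteq> side_box 1 0 r"
proof
  fix z assume "z \<in> interior (side_cbox 1 0 r)"
  then obtain e where e: "e > 0" "ball z e \<subseteq> side_cbox 1 0 r"
    by (meson mem_interior)
  \<comment> \<open>Shifts by \<open>e/2\<close> in the four axis directions stay in the closed box,
    which forces each inequality at \<open>z\<close> to be strict.\<close>
  have d: "z + of_real (e/2) \<in> ball z e" "z - of_real (e/2) \<in> ball z e"
    "z + \<i> * of_real (e/2) \<in> ball z e" "z - \<i> * of_real (e/2) \<in> ball z e"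
    using e(1) by (auto simp: dist_norm norm_mult)
  have "z + of_real (e/2) \<in> side_cbox 1 0 r" "z - of_real (e/2) \<in> side_cbox 1 0 r"
    "z + \<i> * of_real (e/2) \<in> side_cbox 1 0 r" "z - \<i> * of_real (e/2) \<in> side_cbox 1 0 r"
    using d e(2) by blast+
  then show "z \<in> side_box 1 0 r"
    using e(1) by (auto simp: side_cbox_def side_box_def)
qed

lemma frontier_side_cbox:
  assumes "z \<in> frontier (side_cbox 1 0 r)"
  shows "z \<in> side_cbox 1 0 r" "z \<notin> side_box 1 0 r"
  using assms closed_side_cbox[of 1 0 r] open_side_box[of 1 0 r] side_box_subset_side_cbox[of 1 0 r]
  by (auto simp: frontier_def interior_maximal subset_iff)
     (meson interior_maximal subset_iff)

text \<open>
  The weight \<open>exp (N * (r\<^sup>2 - z\<^sup>2 + 2 * \<i> * r * z))\<close> has modulus at most 1 on the three sides of the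
  rectangle off the real axis, while its exponent has real part at least \<open>N * r\<^sup>2 / 2\<close> near the
  midpoint of the real side.
\<close>

lemma two_constants_rectangle:
  fixes f :: "complex \<Rightarrow> complex"
  assumes r: "r > 0" and cont: "continuous_on (side_cbox 1 0 r) f"
    and hol: "f holomorphic_on side_box 1 0 r"
    and M: "\<And>z. z \<in> side_cbox 1 0 r \<Longrightarrow> norm (f z) \<le> M"
    and d: "\<And>t. \<bar>t\<bar> \<le> r \<Longrightarrow> norm (f (of_real t)) \<le> d"
    and N: "N \<ge> 0" and z: "z \<in> side_cbox 1 0 (r/8)"
  shows "norm (f z) \<le> max M (d * exp (N * r\<^sup>2)) * exp (- (N * r\<^sup>2 / 2))"
proof -
  define p where "p = (\<lambda>z::complex. of_real N * (of_real (r\<^sup>2) - z^2 + 2 * \<i> * of_real r * z))"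
  have Re_p: "Re (p z) = N * (r\<^sup>2 - (Re z)\<^sup>2 + (Im z)\<^sup>2 - 2 * r * Im z)" for z
    by (simp add: p_def power2_eq_square algebra_simps)
  define B where "B = max M (d * exp (N * r\<^sup>2))"
  have "0 \<le> norm (f 0)" "norm (f 0) \<le> d"
    using d[of 0] r by auto
  then have d0: "d \<ge> 0" by linarith
  have zin: "z \<in> side_cbox 1 0 r"
    using z r by (auto simp: side_cbox_def)
  have "norm (f z * exp (p z)) \<le> B"
  proof (rule maximum_modulus_frontier[where S = "side_cbox 1 0 r" and f = "\<lambda>z. f z * exp (p z)"])
    show "(\<lambda>z. f z * exp (p z)) holomorphic_on interior (side_cbox 1 0 r)"
      unfolding p_def using holomorphic_on_subset[OF hol interior_side_cbox]
      by (intro holomorphic_intros)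
    show "continuous_on (closure (side_cbox 1 0 r)) (\<lambda>z. f z * exp (p z))"
      unfolding p_def using cont closed_side_cbox
      by (auto intro!: continuous_intros)
    show "bounded (side_cbox 1 0 r)"
      using compact_side_cbox compact_imp_bounded by blast
    show "z \<in> side_cbox 1 0 r" by (rule zin)
  next
    fix w assume "w \<in> frontier (side_cbox 1 0 r)"
    then have w: "w \<in> side_cbox 1 0 r" "w \<notin> side_box 1 0 r"
      using frontier_side_cbox by blast+
    \<comment> \<open>On the real side the bound \<open>d\<close> pays for an exponent of at most
      \<open>N * r^2\<close>; on the other three sides only \<open>M\<close> is known, but the
      exponent is nonpositive.\<close>
    show "norm (f w * exp (p w)) \<le> B"
    proof (cases "Im w = 0")
      case True
      then have wr: "w = of_real (Re w)" "\<bar>Re w\<bar> \<le> r"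
        using w(1) by (auto simp: complex_eq_iff side_cbox_def)
      have "norm (f w) \<le> d"
        using d[OF wr(2)] wr(1) by simp
      moreover have "Re (p w) \<le> N * r\<^sup>2"
        unfolding Re_p using N True by (intro mult_left_mono) auto
      ultimately have "norm (f w) * exp (Re (p w)) \<le> d * exp (N * r\<^sup>2)"
        using d0 by (intro mult_mono) auto
      then show ?thesis by (simp add: norm_mult B_def)
    next
      case False
      then have y: "0 < Im w" "Im w \<le> r" and x: "\<bar>Re w\<bar> = r \<or> Im w = r"
        using w by (auto simp: side_cbox_def side_box_def)
      have "r\<^sup>2 - (Re w)\<^sup>2 + (Im w)\<^sup>2 - 2 * r * Im w \<le> 0"
      proof (cases "Im w = r")
        case True
        then show ?thesis by (simp add: power2_eq_square)
      next
        case False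
        then have "(Re w)\<^sup>2 = r\<^sup>2" using x by (metis power2_abs)
        moreover have "Im w * Im w \<le> r * Im w" using y by (intro mult_right_mono) auto
        moreover have "0 \<le> r * Im w" using y r by auto
        ultimately show ?thesis by (simp add: power2_eq_square)
      qed
      then have "Re (p w) \<le> 0"
        unfolding Re_p using N by (simp add: mult_nonneg_nonpos)
      then have "norm (f w) * exp (Re (p w)) \<le> M * 1"
        using M[OF w(1)] order_trans[OF norm_ge_zero M[OF w(1)]] by (intro mult_mono) auto
      then show ?thesis by (simp add: norm_mult B_def)
    qed
  qed
  then have 1: "norm (f z) * exp (Re (p z)) \<le> B"
    by (simp add: norm_mult)
  \<comment> \<open>Here the exponent divided by \<open>N\<close> is at least
    \<open>r^2 - r^2/64 - r^2/4\<close>, which exceeds \<open>r^2/2\<close>.\<close>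
  have "(Re z)\<^sup>2 \<le> (r/8)\<^sup>2"
    using z r by (intro abs_le_square_iff[THEN iffD1]) (auto simp: side_cbox_def)
  moreover have "2 * r * Im z \<le> 2 * r * (r/8)"
    using z r by (intro mult_left_mono) (auto simp: side_cbox_def)
  moreover have "0 \<le> (Im z)\<^sup>2" by simp
  ultimately have "r\<^sup>2 / 2 \<le> r\<^sup>2 - (Re z)\<^sup>2 + (Im z)\<^sup>2 - 2 * r * Im z"
    by (simp add: power2_eq_square) (use zero_le_square[of r] zero_le_square[of "Im z"] in linarith)
  then have "N * (r\<^sup>2 / 2) \<le> Re (p z)"
    unfolding Re_p using N by (intro mult_left_mono) auto
  then have "norm (f z) * exp (N * r\<^sup>2 / 2) \<le> B"
    using 1 by (smt (verit) exp_le_cancel_iff mult_left_mono norm_ge_zero times_divide_eq_right)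
  then show ?thesis
    unfolding B_def[symmetric] by (simp add: exp_minus field_simps)
qed

text \<open>The affine map \<open>w |-> c + e * w\<close> with \<open>e = 1\<close> or
  \<open>e = -1\<close> carries the upper box at 0 into the given one. For \<open>s = 0\<close> the
  sign \<open>e\<close> follows the half-plane containing \<open>z\<close>, so a whole box is
  treated as two halves.\<close>

lemma side_extension_small:
  assumes r: "r > 0" and s: "s = 0 \<or> s = 1 \<or> s = -1"
    and f: "side_extension s h c r M f"
    and d: "\<And>t. \<bar>t - c\<bar> \<le> r \<Longrightarrow> norm (h t) \<le> d"
    and N: "N \<ge> 0" and z: "z \<in> side_cbox s c (r/8)"
  shows "norm (f z) \<le> max M (d * exp (N * r\<^sup>2)) * exp (- (N * r\<^sup>2 / 2))"
proof -
  define e :: real where "e = (if s = 0 then (if Im z \<ge> 0 then 1 else -1) else s)"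
  have e: "e = 1 \<or> e = -1" "s = 0 \<or> s = e" "0 \<le> e * Im z"
    using s z by (auto simp: e_def side_cbox_def)
  define g where "g = (\<lambda>w. f (of_real c + of_real e * w))"
  have im1: "of_real c + of_real e * w \<in> side_cbox s c r" if "w \<in> side_cbox 1 0 r" for w
    using that e by (auto simp: side_cbox_def)
  have im2: "of_real c + of_real e * w \<in> side_box s c r" if "w \<in> side_box 1 0 r" for w
    using that e by (auto simp: side_box_def)
  have "norm (g (of_real e * (z - of_real c))) \<le> max M (d * exp (N * r\<^sup>2)) * exp (- (N * r\<^sup>2 / 2))"
  proof (rule two_constants_rectangle[where f = g, OF r _ _ _ _ N])
    show "continuous_on (side_cbox 1 0 r) g"
      unfolding g_def using f im1
      by (auto simp: side_extension_def
          intro!: continuous_on_compose2[where g = f and t = "side_cbox s c r"] continuous_intros)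
    have "f \<circ> (\<lambda>w. of_real c + of_real e * w) holomorphic_on side_box 1 0 r"
      by (rule holomorphic_on_compose_gen[where t = "side_box s c r"])
         (use f im2 in \<open>auto simp: side_extension_def intro!: holomorphic_intros\<close>)
    then show "g holomorphic_on side_box 1 0 r" by (simp add: g_def o_def)
    show "norm (g w) \<le> M" if "w \<in> side_cbox 1 0 r" for w
      using f im1[OF that] by (auto simp: g_def side_extension_def)
    show "norm (g (of_real t)) \<le> d" if "\<bar>t\<bar> \<le> r" for t
    proof -
      have t: "\<bar>(c + e * t) - c\<bar> \<le> r" using that e(1) by auto
      then have "g (of_real t) = h (c + e * t)"
        using f by (auto simp: g_def side_extension_def simp flip: of_real_mult of_real_add)
      then show ?thesis using d[OF t] by simp
    qed
    show "of_real e * (z - of_real c) \<in> side_cbox 1 0 (r/8)"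
      using z e r by (auto simp: side_cbox_def abs_minus_commute)
  qed
  moreover have "of_real c + of_real e * (of_real e * (z - of_real c)) = z"
    using e(1) by auto
  ultimately show ?thesis by (simp add: g_def)
qed

section \<open>Algebra and limits of extensions\<close>

lemma side_extension_diff:
  assumes "side_extension s h1 c r M f1" "side_extension s h2 c r M f2"
  shows "side_extension s (\<lambda>t. h1 t - h2 t) c r (2 * M) (\<lambda>z. f1 z - f2 z)"
  using assms unfolding side_extension_def
  by (auto intro!: continuous_intros holomorphic_intros)
     (smt (verit) norm_triangle_ineq4)

lemma side_extension_cong:
  assumes "side_extension s h c r M f" "\<And>t. \<bar>t - c\<bar> \<le> r \<Longrightarrow> h t = h' t"
  shows "side_extension s h' c r M f"
  using assms unfolding side_extension_def by auto

lemma side_extension_cmult: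
  assumes "side_extension s h c r M f"
  shows "side_extension s (\<lambda>t. k * h t) c r (norm k * M) (\<lambda>z. k * f z)"
  using assms unfolding side_extension_def
  by (auto intro!: continuous_intros holomorphic_intros mult_left_mono simp: norm_mult)

lemma side_extension_bilateral_imp_unilateral:
  assumes "side_extension 0 h c r M f"
  shows "side_extension s h c r M f"
proof -
  have "side_cbox s c r \<subseteq> side_cbox 0 c r" "side_box s c r \<subseteq> side_box 0 c r"
    by (auto simp: side_cbox_def side_box_def)
  then show ?thesis
    using assms unfolding side_extension_def
    by (auto intro: continuous_on_subset holomorphic_on_subset)
qed

text \<open>The difference of two of the extensions is bounded by \<open>2 * M\<close> and small on
  the segment, so \<open>side_extension_small\<close> makes the sequence uniformly Cauchy on the box
  of size \<open>r/8\<close>. Holomorphy, the bound \<open>M\<close> and the boundary values pass to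
  the limit.\<close>

lemma side_extension_limit:
  fixes h :: "real \<Rightarrow> complex"
  assumes r: "r > 0" and s: "s = 0 \<or> s = 1 \<or> s = -1"
    and f: "\<And>n. side_extension s (hs n) c r M (f n)"
    and lim: "\<And>n t. \<bar>t - c\<bar> \<le> r \<Longrightarrow> norm (hs n t - h t) \<le> inverse (real (Suc n))"
  shows "\<exists>g. side_extension s h c (r/8) M g"
proof -
  let ?Q = "side_cbox s c (r/8)" and ?I = "side_box s c (r/8)"
  have sub: "?Q \<subseteq> side_cbox s c r" "?I \<subseteq> side_box s c r"
    using r by (auto simp: side_cbox_def side_box_def)
  have "complex_of_real c \<in> side_cbox s c r" using r by (simp add: side_cbox_def)
  then have M0: "M \<ge> 0" using f[of 0] unfolding side_extension_def
    by (meson norm_ge_zero order_trans)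
  have cau: "uniformly_Cauchy_on ?Q f"
    unfolding uniformly_Cauchy_on_def
  proof (intro allI impI)
    fix e :: real assume e: "e > 0"
    \<comment> \<open>\<open>N\<close> is fixed first. Boundary errors below
      \<open>exp (- (N * r^2))\<close> then cancel the growth factor \<open>exp (N * r^2)\<close>,
      so the maximum in the estimate is at most \<open>2 * M + 1\<close>.\<close>
    have "((\<lambda>N. (2 * M + 1) * exp (- (N * r\<^sup>2 / 2))) \<longlongrightarrow> 0) at_top"
      using r by real_asymp
    then have "eventually (\<lambda>N. (2 * M + 1) * exp (- (N * r\<^sup>2 / 2)) < e) at_top"
      using e order_tendstoD(2) by blast
    then have "eventually (\<lambda>N. (2 * M + 1) * exp (- (N * r\<^sup>2 / 2)) < e \<and> N \<ge> 0) at_top"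
      using eventually_ge_at_top[of "0::real"] eventually_conj by blast
    then obtain N where N: "(2 * M + 1) * exp (- (N * r\<^sup>2 / 2)) < e" "N \<ge> 0"
      by (metis (no_types, lifting) eventually_at_top_linorder order_refl)
    \<comment> \<open>The factor 1/2 leaves room for the two errors of the indices \<open>m\<close>
      and \<open>n\<close>.\<close>
    obtain K where K: "inverse (real (Suc K)) < exp (- (N * r\<^sup>2)) / 2"
      using reals_Archimedean[of "exp (- (N * r\<^sup>2)) / 2"] by auto
    show "\<exists>K. \<forall>x\<in>?Q. \<forall>m\<ge>K. \<forall>n\<ge>K. dist (f m x) (f n x) < e"
    proof (intro exI ballI allI impI)
      fix x m n assume x: "x \<in> ?Q" and mn: "K \<le> m" "K \<le> n"
      let ?d = "exp (- (N * r\<^sup>2))"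
      have le: "inverse (real (Suc j)) \<le> inverse (real (Suc K))" if "K \<le> j" for j
        using that by (intro le_imp_inverse_le) auto
      have "norm (f m x - f n x) \<le> max (2 * M) (?d * exp (N * r\<^sup>2)) * exp (- (N * r\<^sup>2 / 2))"
      proof (rule side_extension_small[OF r s side_extension_diff[OF f f] _ N(2) x])
        fix t assume t: "\<bar>t - c\<bar> \<le> r"
        have "norm (hs m t - hs n t) \<le> norm (hs m t - h t) + norm (hs n t - h t)"
          by (metis norm_triangle_ineq4 diff_diff_eq2 diff_add_cancel)
        then show "norm (hs m t - hs n t) \<le> ?d"
          using lim[OF t, of m] lim[OF t, of n] le[OF mn(1)] le[OF mn(2)] K by linarith
      qed
      also have "\<dots> \<le> (2 * M + 1) * exp (- (N * r\<^sup>2 / 2))"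
        using M0 by (intro mult_right_mono) (auto simp: exp_minus)
      finally show "dist (f m x) (f n x) < e"
        using N(1) by (simp add: dist_norm)
    qed
  qed
  obtain g where g: "uniform_limit ?Q f g sequentially"
    using Cauchy_uniformly_convergent[OF cau] unfolding uniformly_convergent_on_def by (elim exE)
  have pt: "(\<lambda>n. f n z) \<longlonglongrightarrow> g z" if "z \<in> ?Q" for z
    by (rule tendsto_uniform_limitI[OF g that])
  have "continuous_on ?Q g"
    using f sub(1) by (intro uniform_limit_theorem[OF always_eventually g])
      (auto simp: side_extension_def intro: continuous_on_subset)
  moreover have "g holomorphic_on ?I"
  proof (rule holomorphic_uniform_sequence[OF open_side_box])
    show "f n holomorphic_on ?I" for n
      using f sub(2) by (auto simp: side_extension_def intro: holomorphic_on_subset)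
    fix x assume "x \<in> ?I"
    then obtain d where "d > 0" "cball x d \<subseteq> ?I"
      using open_side_box open_contains_cball by blast
    then show "\<exists>d. 0 < d \<and> cball x d \<subseteq> ?I \<and> uniform_limit (cball x d) f g sequentially"
      using g side_box_subset_side_cbox by (meson uniform_limit_on_subset order_trans)
  qed
  moreover have "norm (g z) \<le> M" if "z \<in> ?Q" for z
    using that f sub(1) by (intro tendsto_upperbound[OF tendsto_norm[OF pt[OF that]]])
      (auto simp: side_extension_def)
  moreover have "g (of_real t) = h t" if t: "\<bar>t - c\<bar> \<le> r/8" for t
  proof -
    have t': "\<bar>t - c\<bar> \<le> r" using t by linarith
    have "of_real t \<in> ?Q" using t r by (auto simp: side_cbox_def)
    then have "(\<lambda>n. f n (of_real t)) \<longlonglongrightarrow> g (of_real t)" by (rule pt)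
    moreover have "f n (of_real t) = hs n t" for n
      using f[of n] t' by (auto simp: side_extension_def)
    moreover have "(\<lambda>n. hs n t) \<longlonglongrightarrow> h t"
      by (rule LIM_zero_cancel, rule Lim_null_comparison[OF _ LIMSEQ_inverse_real_of_nat])
         (use lim[OF t'] in auto)
    ultimately show ?thesis
      using LIMSEQ_unique by (metis (no_types, lifting) ext)
  qed
  ultimately show ?thesis unfolding side_extension_def by blast
qed

section \<open>A smooth nowhere analytic function\<close>

text \<open>This is the termwise \<open>j\<close>-th derivative of the series of
  \<open>exp (- 2^n) * cos (4^n * t)\<close>: differentiating a cosine shifts its phase by
  \<open>pi / 2\<close>, so one formula covers all orders.\<close>

definition lacunary_cos :: "nat \<Rightarrow> real \<Rightarrow> real" where
  "lacunary_cos j t = (\<Sum>n. exp (- (2 ^ n)) * (4 ^ n) ^ j * cos (4 ^ n * t + real j * (pi / 2)))"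

text \<open>A single term of the exponential series is at most its sum.\<close>

lemma power_le_fact_mult_exp:
  fixes x :: real
  assumes "x \<ge> 0"
  shows "x ^ k \<le> fact k * exp x"
proof -
  have "(\<Sum>n\<in>{k}. x ^ n /\<^sub>R fact n) \<le> (\<Sum>n. x ^ n /\<^sub>R fact n)"
    using assms summable_exp_generic[of x] by (intro sum_le_suminf) auto
  then show ?thesis by (simp add: exp_def field_simps)
qed

text \<open>The exponent \<open>2 * j + 1\<close> at the point \<open>2^n\<close> gives
  \<open>(4^n)^j\<close> times one spare factor \<open>2^n\<close>, and that factor yields a
  geometric majorant.\<close>

lemma lacunary_coefficient_le:
  "exp (- (2 ^ n)) * (4 ^ n) ^ j \<le> fact (2 * j + 1) * (1 / 2 :: real) ^ n"
proof -
  have "(2 ^ n) ^ (2 * j + 1) \<le> fact (2 * j + 1) * exp (2 ^ n :: real)"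
    by (rule power_le_fact_mult_exp) simp
  moreover have "(2 ^ n) ^ (2 * j + 1) = (4 ^ n) ^ j * (2 ^ n :: real)"
    by (simp add: power_mult power_even_eq flip: power_mult_distrib)
       (simp add: power2_eq_square power_mult_distrib[symmetric])
  ultimately have "(4 ^ n) ^ j * (2 ^ n :: real) \<le> fact (2 * j + 1) * exp (2 ^ n :: real)"
    by metis
  then show ?thesis
    by (simp add: exp_minus field_simps power_divide)
qed

lemma norm_lacunary_term_le:
  fixes u :: real
  shows "norm (exp (- (2 ^ n)) * (4 ^ n) ^ j * cos u) \<le> fact (2 * j + 1) * (1 / 2 :: real) ^ n"
proof -
  have "norm (exp (- (2 ^ n)) * (4 ^ n) ^ j * cos u) \<le> exp (- (2 ^ n)) * (4 ^ n) ^ j * (1::real)"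
    unfolding norm_mult by (intro mult_mono) auto
  then show ?thesis using lacunary_coefficient_le[of n j] by linarith
qed

lemma summable_lacunary_majorant: "summable (\<lambda>n. fact (2 * j + 1) * (1 / 2 :: real) ^ n)"
  by (intro summable_mult summable_geometric) auto

lemma summable_lacunary_cos:
  "summable (\<lambda>n. exp (- (2 ^ n)) * (4 ^ n) ^ j * cos (4 ^ n * t + real j * (pi / 2)))"
  by (rule summable_comparison_test'[OF summable_lacunary_majorant norm_lacunary_term_le])

text \<open>Termwise differentiation; the Weierstrass test makes the series of derivatives converge
  uniformly on the whole line.\<close>

lemma has_derivative_lacunary_cos:
  "(lacunary_cos j has_real_derivative lacunary_cos (Suc j) t) (at t)"
proof -
  let ?f = "\<lambda>j n t. exp (- (2 ^ n)) * (4 ^ n) ^ j * cos (4 ^ n * t + real j * (pi / 2)) :: real"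
  have "((\<lambda>t. \<Sum>n. ?f j n t) has_field_derivative (\<Sum>n. ?f (Suc j) n t)) (at t)"
  proof (rule has_field_derivative_series'(2)[where f = "?f j" and f' = "?f (Suc j)"])
    fix n and x :: real
    have "cos (4 ^ n * x + real (Suc j) * (pi / 2)) = - sin (4 ^ n * x + real j * (pi / 2))"
      using cos_add[of "4 ^ n * x + real j * (pi / 2)" "pi / 2"] by (simp add: algebra_simps add_divide_distrib)
    then show "(?f j n has_field_derivative ?f (Suc j) n x) (at x within UNIV)"
      by (auto intro!: derivative_eq_intros)
    show "uniformly_convergent_on UNIV (\<lambda>n x. \<Sum>i<n. ?f (Suc j) i x)"
      by (rule Weierstrass_m_test'[OF norm_lacunary_term_le summable_lacunary_majorant])
    show "summable (\<lambda>n. ?f j n 0)" by (rule summable_lacunary_cos)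
  qed auto
  then show ?thesis unfolding lacunary_cos_def .
qed

text \<open>For \<open>k >= m\<close> the number \<open>4^k * x\<close> is a multiple of
  \<open>2 * pi\<close>, and so is the phase because 4 divides \<open>j\<close>; these cosines all
  equal 1. The term \<open>k = n\<close> alone contributes the left-hand side, as
  \<open>4^n = j^2\<close>, while each of the first \<open>m\<close> terms is at least
  \<open>- (4^m)^j\<close>.\<close>

lemma lacunary_cos_lower_bound:
  fixes p :: int
  assumes n: "m \<le> n" "2 \<le> n" and j: "j = 2 ^ n" and x: "x = 2 * pi * of_int p / 4 ^ m"
  shows "exp (- real j) * (real j ^ 2) ^ j \<le> lacunary_cos j x + real m * (4 ^ m) ^ j"
proof -
  define a where "a = (\<lambda>k. exp (- (2 ^ k)) * (4 ^ k) ^ j * cos (4 ^ k * x + real j * (pi / 2)))"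
  \<comment> \<open>Adding \<open>d\<close> makes every term nonnegative, so that one term bounds
    the whole series from below.\<close>
  define d :: "nat \<Rightarrow> real" where "d = (\<lambda>k. if k \<in> {..<m} then (4 ^ m) ^ j else 0)"
  have a_ge: "a k = exp (- (2 ^ k)) * (4 ^ k) ^ j" if "m \<le> k" for k
  proof -
    obtain q where q: "j = 4 * q"
      using n(2) j by (metis dvdE le_imp_power_dvd num_double power2_eq_square numeral_times_numeral)
    have "(4::real) ^ k = 4 ^ m * 4 ^ (k - m)"
      using that by (simp flip: power_add)
    then have "4 ^ k * x + real j * (pi / 2) = 2 * pi * of_int (p * 4 ^ (k - m) + int q)"
      unfolding x q by (simp add: field_simps)
    then have "cos (4 ^ k * x + real j * (pi / 2)) = 1"
      using cos_int_2pin by metis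
    then show ?thesis by (simp add: a_def)
  qed
  have d_sums: "d sums (real m * (4 ^ m) ^ j)"
    using sums_If_finite_set[of "{..<m}" "\<lambda>_. (4 ^ m) ^ j :: real"] unfolding d_def by simp
  have a_sums: "a sums lacunary_cos j x"
    using summable_sums[OF summable_lacunary_cos[of j x]] unfolding a_def lacunary_cos_def .
  have nonneg: "0 \<le> a k + d k" for k
  proof (cases "m \<le> k")
    case True
    then show ?thesis by (simp add: a_ge d_def)
  next
    case False
    have "\<bar>a k\<bar> \<le> 1 * (4 ^ m) ^ j * 1"
      unfolding a_def abs_mult using False
      by (intro mult_mono) (auto intro!: power_mono power_increasing)
    then show ?thesis using False by (simp add: d_def)
  qed
  have sums: "(\<lambda>k. a k + d k) sums (lacunary_cos j x + real m * (4 ^ m) ^ j)"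
    by (rule sums_add[OF a_sums d_sums])
  have "(\<Sum>k\<in>{n}. a k + d k) \<le> (\<Sum>k. a k + d k)"
    using sums nonneg by (intro sum_le_suminf) (auto simp: sums_iff)
  then have "a n + d n \<le> lacunary_cos j x + real m * (4 ^ m) ^ j"
    using sums by (simp add: sums_iff)
  moreover have "a n + d n = exp (- real j) * (real j ^ 2) ^ j"
    using n by (simp add: a_ge d_def j power2_eq_square flip: power_mult_distrib)
  ultimately show ?thesis by simp
qed

text \<open>Complex derivatives restrict to derivatives along the real axis, and those are
  unique.\<close>

lemma deriv_of_real_eq_lacunary_cos:
  assumes hol: "f holomorphic_on side_box 0 c r"
    and f: "\<And>t. \<bar>t - c\<bar> < r \<Longrightarrow> f (of_real t) = of_real (lacunary_cos 0 t)"
    and t: "\<bar>t - c\<bar> < r"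
  shows "(deriv ^^ j) f (of_real t) = of_real (lacunary_cos j t)"
  using t
proof (induction j arbitrary: t)
  case 0
  then show ?case by (simp add: f)
next
  case (Suc j)
  have "of_real t \<in> side_box 0 c r"
    using Suc.prems by (auto simp: side_box_def)
  moreover have "(deriv ^^ j) f holomorphic_on side_box 0 c r"
    using holomorphic_higher_deriv hol open_side_box by blast
  ultimately have "((deriv ^^ j) f has_field_derivative (deriv ^^ Suc j) f (of_real t)) (at (of_real t))"
    using holomorphic_derivI open_side_box by simp
  then have 1: "((\<lambda>t. (deriv ^^ j) f (of_real t)) has_vector_derivative (deriv ^^ Suc j) f (of_real t)) (at t)"
    by (rule has_vector_derivative_real_field)
  have "((\<lambda>t. complex_of_real (lacunary_cos j t)) has_vector_derivative of_real (lacunary_cos (Suc j) t)) (at t)"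
    using has_derivative_lacunary_cos has_vector_derivative_of_real
      has_real_derivative_iff_has_vector_derivative by blast
  moreover have "t \<in> ball c r" using Suc.prems by (simp add: dist_real_def abs_minus_commute)
  moreover have "complex_of_real (lacunary_cos j u) = (deriv ^^ j) f (of_real u)" if "u \<in> ball c r" for u
    using Suc.IH[of u] that by (simp add: dist_real_def abs_minus_commute)
  ultimately have "((\<lambda>t. (deriv ^^ j) f (of_real t)) has_vector_derivative of_real (lacunary_cos (Suc j) t)) (at t)"
    by (rule has_vector_derivative_transform_within_open[OF _ open_ball])
  then show ?case using 1 vector_derivative_unique_at by blast
qed

text \<open>Cauchy's inequality allows derivatives of size about \<open>(K * j)^j\<close>, whereas
  at a grid point near \<open>c\<close> the \<open>j\<close>-th derivative grows like
  \<open>exp (- j) * j^(2 * j)\<close> along \<open>j = 2^n\<close>.\<close>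

lemma lacunary_cos_nowhere_analytic:
  assumes r: "r > 0" and hol: "f holomorphic_on side_box 0 c r"
    and f: "\<And>t. \<bar>t - c\<bar> < r \<Longrightarrow> f (of_real t) = of_real (lacunary_cos 0 t)"
  shows False
proof -
  \<comment> \<open>The grid of multiples of \<open>2 * pi / 4^m\<close> is finer than
    \<open>r\<close>, so the last grid point \<open>x\<close> not exceeding \<open>c\<close> lies
    within \<open>r\<close> of \<open>c\<close>.\<close>
  obtain m where m: "2 * pi / r < 4 ^ m"
    using real_arch_pow[of 4] by auto
  define p where "p = \<lfloor>c * 4 ^ m / (2 * pi)\<rfloor>"
  define x where "x = 2 * pi * of_int p / 4 ^ m"
  have "of_int p \<le> c * 4 ^ m / (2 * pi)" "c * 4 ^ m / (2 * pi) < of_int p + 1"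
    unfolding p_def by linarith+
  then have "x \<le> c" "c < x + 2 * pi / 4 ^ m"
    by (auto simp: x_def field_simps)
  moreover have "2 * pi / 4 ^ m < r"
    using m r by (simp add: field_simps)
  ultimately have xc: "\<bar>x - c\<bar> < r" by linarith
  define R where "R = (r - \<bar>x - c\<bar>) / 2"
  have R: "R > 0" using xc by (simp add: R_def)
  have sub: "cball (of_real x) R \<subseteq> side_box 0 c r"
  proof
    fix z assume "z \<in> cball (complex_of_real x) R"
    then have "norm (z - of_real x) \<le> R" by (simp add: dist_norm norm_minus_commute)
    then have "\<bar>Re z - x\<bar> \<le> R" "\<bar>Im z\<bar> \<le> R"
      using abs_Re_le_cmod[of "z - of_real x"] abs_Im_le_cmod[of "z - of_real x"] by auto
    moreover have "R < r - \<bar>x - c\<bar>" using xc unfolding R_def by (simp add: field_simps)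
    ultimately have "\<bar>Re z - c\<bar> < r" "\<bar>Im z\<bar> < r" by linarith+
    then show "z \<in> side_box 0 c r" by (simp add: side_box_def)
  qed
  have cont: "continuous_on (cball (of_real x) R) f"
    by (rule continuous_on_subset[OF holomorphic_on_imp_continuous_on[OF hol] sub])
  have "bounded (f ` cball (of_real x) R)"
    by (rule compact_imp_bounded[OF compact_continuous_image[OF cont compact_cball]])
  then obtain B where B: "B > 0" "\<And>z. z \<in> cball (of_real x) R \<Longrightarrow> norm (f z) \<le> B"
    by (auto simp: bounded_pos)
  have upper: "\<bar>lacunary_cos j x\<bar> \<le> fact j * B / R ^ j" for j
  proof -
    have "norm ((deriv ^^ j) f (of_real x)) \<le> fact j * B / R ^ j"
      by (rule Cauchy_inequality[OF holomorphic_on_subset[OF hol] cont R B(2)])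
         (use sub ball_subset_cball in \<open>auto simp: dist_norm\<close>)
    then show ?thesis
      using deriv_of_real_eq_lacunary_cos[OF hol f xc] by simp
  qed
  \<comment> \<open>\<open>K\<close> absorbs both the Cauchy rate \<open>1 / R\<close> and the size
    \<open>4^m\<close> of the low-frequency terms.\<close>
  define K where "K = max (1 / R) (4 ^ m)"
  have K: "K \<ge> 1 / R" "K \<ge> 4 ^ m" "K \<ge> 1"
    by (auto simp: K_def le_max_iff_disj)
  \<comment> \<open>Since \<open>n < j\<close>, the first bound gives
    \<open>j >= 2 * exp 1 * K\<close>, hence a gain of \<open>2^j\<close>; the second gives
    \<open>B + m < j\<close>. Together they lead to \<open>2^j <= B + m < j\<close>, a
    contradiction.\<close>
  obtain n where n: "real n \<ge> max (2 * exp 1 * K) (B + real m + 1)" "n \<ge> m" "n \<ge> 2"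
  proof -
    obtain n0 where "real n0 \<ge> max (2 * exp 1 * K) (B + real m + 1)"
      using real_arch_simple by blast
    then show thesis by (intro that[of "max n0 (max m 2)"]) auto
  qed
  define j where "j = (2::nat) ^ n"
  have jn: "n < j" by (simp add: j_def)
  then have j: "real j \<ge> 2 * exp 1 * K" "real j > B + real m" "real j \<ge> 1"
    using n(1) by auto
  have "exp (- real j) * (real j ^ 2) ^ j \<le> fact j * B / R ^ j + real m * (4 ^ m) ^ j"
    using lacunary_cos_lower_bound[OF n(2,3) j_def x_def] upper[of j] by linarith
  also have "\<dots> \<le> B * (real j * K) ^ j + real m * (real j * K) ^ j"
  proof (intro add_mono mult_left_mono)
    have "fact j \<le> real j ^ j" using fact_le_power[of j, where ?'a = real] by simp
    then have "fact j * (1 / R) ^ j \<le> real j ^ j * K ^ j"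
      using K R by (intro mult_mono power_mono) auto
    then have "B * (fact j * (1 / R) ^ j) \<le> B * (real j ^ j * K ^ j)"
      using B(1) by (intro mult_left_mono) auto
    then show "fact j * B / R ^ j \<le> B * (real j * K) ^ j"
      by (simp add: power_divide power_mult_distrib mult_ac)
    have "1 * 4 ^ m \<le> real j * K"
      using j K by (intro mult_mono) auto
    then show "(4 ^ m) ^ j \<le> (real j * K) ^ j"
      by (intro power_mono) auto
  qed auto
  also have "\<dots> = (B + real m) * (real j * K) ^ j"
    by (simp add: algebra_simps)
  finally have 1: "exp (- real j) * (real j ^ 2) ^ j \<le> (B + real m) * (real j * K) ^ j" .
  have "exp (real j) = exp 1 ^ j"
    by (simp flip: exp_of_nat_mult)
  then have "(real j ^ 2) ^ j \<le> (B + real m) * (exp 1 * (real j * K)) ^ j"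
    using 1 by (simp add: exp_minus power_mult_distrib field_simps)
  moreover have "(2 * (exp 1 * (real j * K))) ^ j \<le> (real j ^ 2) ^ j"
  proof (rule power_mono)
    have "real j * (2 * exp 1 * K) \<le> real j * real j"
      using j by (intro mult_left_mono) auto
    then show "2 * (exp 1 * (real j * K)) \<le> real j ^ 2"
      by (simp add: power2_eq_square mult_ac)
  qed (use j K in auto)
  ultimately have "2 ^ j * (exp 1 * (real j * K)) ^ j \<le> (B + real m) * (exp 1 * (real j * K)) ^ j"
    by (simp only: power_mult_distrib)
  moreover have "(exp 1 * (real j * K)) ^ j > 0"
    using j K by (intro zero_less_power mult_pos_pos) auto
  ultimately have "2 ^ j \<le> B + real m"
    using mult_le_cancel_right_pos by blast
  moreover have "real j < 2 ^ j" by (metis of_nat_less_two_power)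
  ultimately show False using j by linarith
qed

text \<open>The boundary values are real, so Schwarz reflection produces a holomorphic function on
  the whole box.\<close>

lemma lacunary_cos_no_upper_extension:
  assumes r: "r > 0" and f: "side_extension 1 (\<lambda>t. of_real (lacunary_cos 0 t)) c r M f"
  shows False
proof -
  let ?S = "side_box 0 c r"
  let ?F = "\<lambda>z. if 0 \<le> Im z then f z else cnj (f (cnj z))"
  have "?F holomorphic_on ?S"
  proof (rule Schwarz_reflection[OF open_side_box])
    show "cnj ` ?S \<subseteq> ?S" by (auto simp: side_box_def)
    have "?S \<inter> {z. 0 < Im z} \<subseteq> side_box 1 c r" by (auto simp: side_box_def)
    then show "f holomorphic_on ?S \<inter> {z. 0 < Im z}"
      using f by (auto simp: side_extension_def intro: holomorphic_on_subset)
    have "?S \<inter> {z. 0 \<le> Im z} \<subseteq> side_cbox 1 c r" by (auto simp: side_box_def side_cbox_def)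
    then show "continuous_on (?S \<inter> {z. 0 \<le> Im z}) f"
      using f by (auto simp: side_extension_def intro: continuous_on_subset)
    show "f z \<in> \<real>" if "z \<in> ?S" "z \<in> \<real>" for z
      using that f by (auto simp: side_extension_def side_box_def elim!: Reals_cases)
  qed
  moreover have "?F (of_real t) = of_real (lacunary_cos 0 t)" if "\<bar>t - c\<bar> < r" for t
    using that f by (auto simp: side_extension_def)
  ultimately show False using lacunary_cos_nowhere_analytic[OF r] by blast
qed

text \<open>Conjugating argument and value turns a lower extension into an upper one and keeps the
  real boundary values.\<close>

lemma lacunary_cos_no_side_extension:
  assumes r: "r > 0" and s: "s = 1 \<or> s = -1"
    and f: "side_extension s (\<lambda>t. of_real (lacunary_cos 0 t)) c r M f"
  shows False
  using s
proof
  assume "s = 1"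
  then show False using lacunary_cos_no_upper_extension r f by blast
next
  assume s: "s = -1"
  have cnj_box: "cnj ` side_box 1 c r = side_box s c r"
  proof
    show "side_box s c r \<subseteq> cnj ` side_box 1 c r"
    proof
      fix z assume "z \<in> side_box s c r"
      then have "cnj z \<in> side_box 1 c r" using s by (auto simp: side_box_def)
      then show "z \<in> cnj ` side_box 1 c r" by (metis complex_cnj_cnj imageI)
    qed
  qed (use s in \<open>auto simp: side_box_def\<close>)
  have "side_extension 1 (\<lambda>t. of_real (lacunary_cos 0 t)) c r M (cnj \<circ> f \<circ> cnj)"
    unfolding side_extension_def
  proof (intro conjI)
    have "continuous_on (side_cbox 1 c r) (\<lambda>z. cnj (f (cnj z)))"
    proof (rule continuous_on_cnj, rule continuous_on_compose2[of "side_cbox s c r" f])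
      show "continuous_on (side_cbox s c r) f" using f by (simp add: side_extension_def)
      show "continuous_on (side_cbox 1 c r) cnj" by (rule continuous_on_cnj[OF continuous_on_id])
      show "cnj ` side_cbox 1 c r \<subseteq> side_cbox s c r" using s by (auto simp: side_cbox_def)
    qed
    then show "continuous_on (side_cbox 1 c r) (cnj \<circ> f \<circ> cnj)" by (simp add: o_def)
    show "cnj \<circ> f \<circ> cnj holomorphic_on side_box 1 c r"
      using f cnj_box open_side_box
      by (intro holomorphic_on_compose_cnj_cnj) (auto simp: side_extension_def)
  qed (use f s in \<open>auto simp: side_extension_def side_cbox_def\<close>)
  then show False using lacunary_cos_no_upper_extension r by blast
qed

section \<open>The spaces of smooth functions on the curve\<close>

text \<open>\<open>iter_deriv\<close> is built from \<open>vector_derivative\<close>, so it is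
  computed by comparison with an explicit chain \<open>G\<close> of successive derivatives.
  Uniqueness of the derivative within \<open>{a..b}\<close> rests on \<open>a < b\<close>.\<close>

lemma iter_deriv_eqI:
  assumes "a < b" and G0: "\<And>t. t \<in> {a..b} \<Longrightarrow> G 0 t = g t"
    and G': "\<And>j t. enat j < k \<Longrightarrow> t \<in> {a..b} \<Longrightarrow>
      (G j has_vector_derivative G (Suc j) t) (at t within {a..b})"
    and "enat j \<le> k" "t \<in> {a..b}"
  shows "iter_deriv a b j g t = G j t"
  using assms(4,5)
proof (induction j arbitrary: t)
  case 0
  then show ?case using G0 by simp
next
  case (Suc j)
  have j: "enat j < k" "enat j \<le> k"
    using Suc.prems(1) by (auto simp: Suc_ile_eq)
  have "(iter_deriv a b j g has_vector_derivative G (Suc j) t) (at t within {a..b})"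
    by (rule has_vector_derivative_transform[OF Suc.prems(2) _ G'[OF j(1) Suc.prems(2)]])
       (use Suc.IH[OF j(2)] in auto)
  then show ?case
    using vector_derivative_within_cbox[of a b] \<open>a < b\<close> Suc.prems(2) by simp
qed

lemma Ck_intervalI:
  assumes "a < b" and G0: "\<And>t. t \<in> {a..b} \<Longrightarrow> G 0 t = g t"
    and G': "\<And>j t. enat j < k \<Longrightarrow> t \<in> {a..b} \<Longrightarrow>
      (G j has_vector_derivative G (Suc j) t) (at t within {a..b})"
    and cont: "\<And>j. enat j \<le> k \<Longrightarrow> continuous_on {a..b} (G j)"
  shows "Ck_interval a b k g"
  unfolding Ck_interval_def
proof (intro conjI allI impI ballI)
  note eq = iter_deriv_eqI[where G = G and k = k, OF \<open>a < b\<close> G0 G']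
  show "continuous_on {a..b} (iter_deriv a b j g)" if "enat j \<le> k" for j
    using continuous_on_cong[OF refl eq[OF _ _ _ that], of "{a..b}"] cont[OF that] by simp
  show "(iter_deriv a b j g has_vector_derivative iter_deriv a b (Suc j) g t) (at t within {a..b})"
    if j: "enat j < k" and t: "t \<in> {a..b}" for j t
  proof -
    have j': "enat j \<le> k" "enat (Suc j) \<le> k"
      using j by (auto simp: Suc_ile_eq)
    have "iter_deriv a b (Suc j) g t = G (Suc j) t"
      by (rule eq) (use j' t in auto)
    then show ?thesis
      using has_vector_derivative_transform[OF t _ G'[OF j t], of "iter_deriv a b j g"] eq[OF _ _ _ j'(1)]
      by simp
  qed
qed

lemma
  assumes "a < b" and g: "Ck_interval a b k g" and h: "Ck_interval a b k h"
  shows Ck_interval_lincomb: "Ck_interval a b k (\<lambda>t. g t + c * h t)"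
    and iter_deriv_lincomb: "\<And>j t. enat j \<le> k \<Longrightarrow> t \<in> {a..b} \<Longrightarrow>
      iter_deriv a b j (\<lambda>t. g t + c * h t) t = iter_deriv a b j g t + c * iter_deriv a b j h t"
proof -
  let ?G = "\<lambda>j t. iter_deriv a b j g t + c * iter_deriv a b j h t"
  have G': "(?G j has_vector_derivative ?G (Suc j) t) (at t within {a..b})"
    if "enat j < k" "t \<in> {a..b}" for j t
    using g h that unfolding Ck_interval_def
    by (intro has_vector_derivative_add has_vector_derivative_mult_right) auto
  have cont: "continuous_on {a..b} (?G j)" if "enat j \<le> k" for j
    using g h that unfolding Ck_interval_def by (intro continuous_intros) auto
  show "Ck_interval a b k (\<lambda>t. g t + c * h t)"
    by (rule Ck_intervalI[where G = ?G, OF \<open>a < b\<close> _ G' cont]) auto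
  show "\<And>j t. enat j \<le> k \<Longrightarrow> t \<in> {a..b} \<Longrightarrow>
      iter_deriv a b j (\<lambda>t. g t + c * h t) t = ?G j t"
    by (rule iter_deriv_eqI[where G = ?G and k = k, OF \<open>a < b\<close> _ G']) auto
qed

section \<open>Linear structure, seminorms and topology of \<open>Ck_curve\<close>\<close>

lemma Ck_curve_lincomb:
  assumes "a < b" "u \<in> Ck_curve a b \<gamma> k" "v \<in> Ck_curve a b \<gamma> k"
  shows "(\<lambda>z. u z + c * v z) \<in> Ck_curve a b \<gamma> k"
  using assms Ck_interval_lincomb[of a b k "u \<circ> \<gamma>" "v \<circ> \<gamma>" c]
  by (auto simp: Ck_curve_def o_def)

lemma Ck_curve_diff:
  assumes "a < b" "u \<in> Ck_curve a b \<gamma> k" "v \<in> Ck_curve a b \<gamma> k"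
  shows "(\<lambda>z. u z - v z) \<in> Ck_curve a b \<gamma> k"
  using Ck_curve_lincomb[OF assms, of "-1"] by simp

lemma norm_iter_deriv_le_ck_seminorm:
  assumes "u \<in> Ck_curve a b \<gamma> k" "enat l \<le> k" "t \<in> {a..b}"
  shows "norm (iter_deriv a b l (u \<circ> \<gamma>) t) \<le> ck_seminorm a b \<gamma> l u"
proof -
  \<comment> \<open>Continuity on a compact interval makes the set bounded above, as the real
    \<open>Sup\<close> requires.\<close>
  have "continuous_on {a..b} (\<lambda>t. norm (iter_deriv a b l (u \<circ> \<gamma>) t))"
    using assms by (auto simp: Ck_curve_def Ck_interval_def intro: continuous_on_norm)
  then have "bdd_above ((\<lambda>t. norm (iter_deriv a b l (u \<circ> \<gamma>) t)) ` {a..b})"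
    by (intro bounded_imp_bdd_above compact_imp_bounded compact_continuous_image compact_Icc)
  then show ?thesis
    unfolding ck_seminorm_def using assms(3) by (intro cSup_upper) auto
qed

lemma ck_seminorm_lincomb_le:
  assumes "a < b" "u \<in> Ck_curve a b \<gamma> k" "v \<in> Ck_curve a b \<gamma> k" "enat l \<le> k"
  shows "ck_seminorm a b \<gamma> l (\<lambda>z. u z + c * v z) \<le> ck_seminorm a b \<gamma> l u + norm c * ck_seminorm a b \<gamma> l v"
proof -
  have "norm (iter_deriv a b l ((\<lambda>z. u z + c * v z) \<circ> \<gamma>) t)
      \<le> ck_seminorm a b \<gamma> l u + norm c * ck_seminorm a b \<gamma> l v" if t: "t \<in> {a..b}" for t
  proof -
    have "iter_deriv a b l ((\<lambda>z. u z + c * v z) \<circ> \<gamma>) t =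
        iter_deriv a b l (u \<circ> \<gamma>) t + c * iter_deriv a b l (v \<circ> \<gamma>) t"
      using iter_deriv_lincomb[of a b k "u \<circ> \<gamma>" "v \<circ> \<gamma>" l t c] assms t
      by (simp add: Ck_curve_def o_def)
    also have "norm \<dots> \<le> norm (iter_deriv a b l (u \<circ> \<gamma>) t) + norm c * norm (iter_deriv a b l (v \<circ> \<gamma>) t)"
      by (metis norm_triangle_ineq norm_mult)
    also have "\<dots> \<le> ck_seminorm a b \<gamma> l u + norm c * ck_seminorm a b \<gamma> l v"
      using norm_iter_deriv_le_ck_seminorm assms t by (intro add_mono mult_left_mono) auto
    finally show ?thesis .
  qed
  then show ?thesis
    unfolding ck_seminorm_def[of a b \<gamma> l "\<lambda>z. u z + c * v z"]
    using \<open>a < b\<close> by (intro cSup_least) auto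
qed

lemma ck_seminorm_nonneg:
  assumes "a < b" "u \<in> Ck_curve a b \<gamma> k" "enat l \<le> k"
  shows "0 \<le> ck_seminorm a b \<gamma> l u"
  using norm_iter_deriv_le_ck_seminorm[OF assms(2,3), of a] assms(1)
  by (meson atLeastAtMost_iff less_eq_real_def norm_ge_zero order_trans order_refl)

lemma ck_seminorm_zero_diff:
  assumes "a < b"
  shows "ck_seminorm a b \<gamma> 0 (\<lambda>z. u z - u z) = 0"
proof -
  have "(\<lambda>t. norm (iter_deriv a b 0 ((\<lambda>z. u z - u z) \<circ> \<gamma>) t)) ` {a..b} = {0}"
    using assms by (auto simp: image_def)
  then show ?thesis unfolding ck_seminorm_def by simp
qed

text \<open>The generating sets with \<open>l = 0\<close>: for every \<open>k\<close> the topology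
  is at least as fine as uniform convergence, the only closeness that the closure argument
  uses.\<close>

lemma openin_ck_topology_sup_ball:
  assumes "u \<in> Ck_curve a b \<gamma> k" "e > 0"
  shows "openin (ck_topology a b \<gamma> k)
    {v \<in> Ck_curve a b \<gamma> k. ck_seminorm a b \<gamma> 0 (\<lambda>z. v z - u z) < e}"
proof -
  have "{v \<in> Ck_curve a b \<gamma> k. ck_seminorm a b \<gamma> 0 (\<lambda>z. v z - u z) < e} =
    {v \<in> Ck_curve a b \<gamma> k. \<forall>j\<le>0. ck_seminorm a b \<gamma> j (\<lambda>z. v z - u z) < e}" by simp
  moreover have "enat 0 \<le> k" by (simp flip: zero_enat_def)
  ultimately show ?thesis
    unfolding ck_topology_def using assms by (intro topology_generated_by_Basis) blast
qed

lemma topspace_ck_topology: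
  assumes "a < b"
  shows "topspace (ck_topology a b \<gamma> k) = Ck_curve a b \<gamma> k"
proof
  show "topspace (ck_topology a b \<gamma> k) \<subseteq> Ck_curve a b \<gamma> k"
    unfolding ck_topology_def topology_generated_by_topspace by blast
  show "Ck_curve a b \<gamma> k \<subseteq> topspace (ck_topology a b \<gamma> k)"
  proof
    fix u assume u: "u \<in> Ck_curve a b \<gamma> k"
    then have "u \<in> {v \<in> Ck_curve a b \<gamma> k. ck_seminorm a b \<gamma> 0 (\<lambda>z. v z - u z) < 1}"
      using ck_seminorm_zero_diff[OF assms] by simp
    then show "u \<in> topspace (ck_topology a b \<gamma> k)"
      using openin_subset[OF openin_ck_topology_sup_ball[OF u, of 1]] by auto
  qed
qed

text \<open>Density will be tested along one direction \<open>v\<close> only. In a generating set,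
  finitely many strict inequalities leave a positive margin, and small multiples of \<open>v\<close>
  stay within it.\<close>

lemma openin_ck_topology_line:
  assumes "a < b" and v: "v \<in> Ck_curve a b \<gamma> k"
    and "openin (ck_topology a b \<gamma> k) T" "u \<in> T"
  shows "\<exists>e>0. \<forall>s::real. \<bar>s\<bar> < e \<longrightarrow> (\<lambda>z. u z + of_real s * v z) \<in> T"
proof -
  from assms(3) have "generate_topology_on
     {{v \<in> Ck_curve a b \<gamma> k. \<forall>j\<le>l. ck_seminorm a b \<gamma> j (\<lambda>z. v z - u z) < \<epsilon>}
       | u l \<epsilon>. u \<in> Ck_curve a b \<gamma> k \<and> enat l \<le> k \<and> \<epsilon> > 0} T"
    unfolding ck_topology_def by (rule openin_topology_generated_by)
  then show ?thesis using \<open>u \<in> T\<close>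
  proof (induction rule: generate_topology_on.induct)
    case Empty
    then show ?case by simp
  next
    case (Int S T)
    then obtain d e where "d > 0" "e > 0"
      "\<forall>s::real. \<bar>s\<bar> < d \<longrightarrow> (\<lambda>z. u z + of_real s * v z) \<in> S"
      "\<forall>s::real. \<bar>s\<bar> < e \<longrightarrow> (\<lambda>z. u z + of_real s * v z) \<in> T" by blast
    then show ?case by (intro exI[of _ "min d e"]) auto
  next
    case (UN K)
    then show ?case by blast
  next
    case (Basis S)
    then obtain w l \<epsilon> where S: "S = {v \<in> Ck_curve a b \<gamma> k. \<forall>j\<le>l. ck_seminorm a b \<gamma> j (\<lambda>z. v z - w z) < \<epsilon>}"
      and w: "w \<in> Ck_curve a b \<gamma> k" "enat l \<le> k" by blast
    have u: "u \<in> Ck_curve a b \<gamma> k" "\<forall>j\<le>l. ck_seminorm a b \<gamma> j (\<lambda>z. u z - w z) < \<epsilon>"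
      using Basis.prems S by auto
    let ?p = "\<lambda>j. ck_seminorm a b \<gamma> j"
    \<comment> \<open>The margin is \<open>\<epsilon> - m\<close>, as \<open>u\<close> may differ
      from the centre \<open>w\<close>.\<close>
    define m where "m = Max ((\<lambda>j. ?p j (\<lambda>z. u z - w z)) ` {..l})"
    have m: "m < \<epsilon>" "?p j (\<lambda>z. u z - w z) \<le> m" if "j \<le> l" for j
      using that u(2) unfolding m_def by auto
    \<comment> \<open>\<open>C\<close> dominates every relevant seminorm of \<open>v\<close>; the
      summand 1 keeps it positive for the division.\<close>
    define C where "C = 1 + (\<Sum>j\<le>l. ?p j v)"
    have jk: "enat j \<le> k" if "j \<le> l" for j
      using that w(2) by (meson enat_ord_simps(1) order_trans)
    have nn: "0 \<le> ?p j v" if "j \<le> l" for j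
      using ck_seminorm_nonneg[OF \<open>a < b\<close> v jk[OF that]] .
    have C: "?p j v \<le> C" if "j \<le> l" for j
      using member_le_sum[of j "{..l}" "\<lambda>j. ?p j v"] that nn unfolding C_def by force
    have C0: "C > 0" using sum_nonneg[of "{..l}" "\<lambda>j. ?p j v"] nn unfolding C_def by force
    show ?case
    proof (intro exI[of _ "(\<epsilon> - m) / C"] conjI allI impI)
      show "0 < (\<epsilon> - m) / C" using C0 m(1)[of 0] by simp
      fix s :: real assume s: "\<bar>s\<bar> < (\<epsilon> - m) / C"
      have "?p j (\<lambda>z. u z + of_real s * v z - w z) < \<epsilon>" if j: "j \<le> l" for j
      proof -
        have "?p j (\<lambda>z. (u z - w z) + of_real s * v z) \<le> ?p j (\<lambda>z. u z - w z) + norm (of_real s :: complex) * ?p j v"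
          by (rule ck_seminorm_lincomb_le[OF \<open>a < b\<close> Ck_curve_diff[OF \<open>a < b\<close> u(1) w(1)] v jk[OF j]])
        also have "\<dots> \<le> m + \<bar>s\<bar> * C"
          using m(2)[OF j] C[OF j] by (intro add_mono mult_mono) (auto simp: nn[OF j])
        also have "\<dots> < \<epsilon>" using s C0 by (simp add: field_simps)
        finally show ?thesis by (simp add: algebra_simps)
      qed
      then show "(\<lambda>z. u z + of_real s * v z) \<in> S"
        unfolding S using Ck_curve_lincomb[OF \<open>a < b\<close> u(1) v] by simp
    qed
  qed
qed

text \<open>The lacunary series is transported by the inverse of \<open>\<gamma>\<close> and set to
  0 off the curve, as \<open>Ck_curve\<close> demands.\<close>

lemma lacunary_curve_function:
  assumes "a < b" "inj_on \<gamma> {a..b}"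
  obtains v where "v \<in> Ck_curve a b \<gamma> k" "\<And>t. t \<in> {a..b} \<Longrightarrow> v (\<gamma> t) = of_real (lacunary_cos 0 t)"
proof
  define v :: "complex \<Rightarrow> complex" where
    "v = (\<lambda>z. if z \<in> curve_img a b \<gamma> then of_real (lacunary_cos 0 (the_inv_into {a..b} \<gamma> z)) else 0)"
  show eq: "v (\<gamma> t) = of_real (lacunary_cos 0 t)" if "t \<in> {a..b}" for t
    using that assms(2) by (simp add: v_def curve_img_def the_inv_into_f_f)
  have der: "((\<lambda>t. complex_of_real (lacunary_cos j t)) has_vector_derivative of_real (lacunary_cos (Suc j) t))
      (at t within {a..b})" for j t
    using has_derivative_lacunary_cos has_vector_derivative_of_real has_vector_derivative_at_within
      has_real_derivative_iff_has_vector_derivative by blast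
  have "Ck_interval a b k (v \<circ> \<gamma>)"
  proof (rule Ck_intervalI[where G = "\<lambda>j t. of_real (lacunary_cos j t)", OF \<open>a < b\<close>])
    show "continuous_on {a..b} (\<lambda>t. complex_of_real (lacunary_cos j t))" for j
      by (rule continuous_on_vector_derivative[OF der])
  qed (use der eq in auto)
  then show "v \<in> Ck_curve a b \<gamma> k"
    by (simp add: Ck_curve_def v_def)
qed

section \<open>Straightening the curve\<close>

definition side_domain :: "real \<Rightarrow> complex set \<Rightarrow> (complex \<Rightarrow> complex) \<Rightarrow> complex set" where
  "side_domain s V F = F ` (V \<inter> {z. s = 0 \<or> 0 < s * Im z})"

lemma K_plus_eq_side_domain: "K_plus V F = side_domain 1 V F"
  by (simp add: K_plus_def side_domain_def)

lemma K_minus_eq_side_domain: "K_minus V F = side_domain (-1) V F"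
  by (simp add: K_minus_def side_domain_def)

text \<open>The triples are centre, half side and bound. Rational and natural entries keep the
  family countable, for the category-type union as well as for the pigeonhole in the density
  proof.\<close>

definition rational_boxes :: "real \<Rightarrow> real \<Rightarrow> complex set \<Rightarrow> (real \<times> real \<times> real) set" where
  "rational_boxes a b V = {(c, r, M). c \<in> \<rat> \<and> r \<in> \<rat> \<and> M \<in> \<nat> \<and> 0 < r \<and> a \<le> c - r \<and> c + r \<le> b \<and>
     side_cbox 0 c r \<subseteq> V}"

definition side_extendable :: "real \<Rightarrow> real \<Rightarrow> complex set \<Rightarrow> real \<Rightarrow> (real \<Rightarrow> complex) \<Rightarrow> bool" where
  "side_extendable a b V s h \<longleftrightarrow>
     (\<exists>(c, r, M) \<in> rational_boxes a b V. \<exists>f. side_extension s h c r M f)"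

lemma countable_rational_boxes: "countable (rational_boxes a b V)"
proof -
  have "rational_boxes a b V \<subseteq> \<rat> \<times> \<rat> \<times> \<nat>"
    by (auto simp: rational_boxes_def)
  moreover have "countable (\<nat> :: real set)"
    unfolding Nats_def by simp
  ultimately show ?thesis
    by (meson countable_SIGMA countable_rat countable_subset)
qed

text \<open>The extension is pulled back by \<open>F\<close> to a small rational box. Continuity is
  asked only inside \<open>W\<close>, which covers both \<open>extends_holo_to\<close> and
  holomorphy on a disk.\<close>

lemma side_extendable_if_local_extension:
  assumes "a < b" and F: "analytic_curve_data a b \<gamma> V F"
    and W: "open W" "W \<inter> curve_img a b \<gamma> \<noteq> {}"
    and cont: "continuous_on (W \<inter> (curve_img a b \<gamma> \<union> side_domain s V F)) lam"
    and hol: "lam holomorphic_on (W \<inter> side_domain s V F)"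
    and eq: "\<And>z. z \<in> W \<inter> curve_img a b \<gamma> \<Longrightarrow> lam z = u z"
  shows "side_extendable a b V s (u \<circ> \<gamma>)"
proof -
  have V: "open V" "F holomorphic_on V" and F\<gamma>: "\<And>t. t \<in> {a..b} \<Longrightarrow> F (of_real t) = \<gamma> t"
    and Vt: "\<And>t. t \<in> {a..b} \<Longrightarrow> of_real t \<in> V"
    using F by (auto simp: analytic_curve_data_def)
  obtain t0 where t0: "t0 \<in> {a..b}" "\<gamma> t0 \<in> W"
    using W(2) unfolding curve_img_def by blast
  have "open (V \<inter> F -` W)"
    using continuous_open_preimage[OF holomorphic_on_imp_continuous_on[OF V(2)] V(1) W(1)] .
  moreover have "of_real t0 \<in> V \<inter> F -` W"
    using t0 F\<gamma> Vt by auto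
  ultimately obtain e where e: "e > 0" "ball (of_real t0) e \<subseteq> V \<inter> F -` W"
    by (meson open_contains_ball)
  \<comment> \<open>The point \<open>t0\<close> may be an endpoint, so a new rational centre is
    chosen strictly inside the part of \<open>{a..b}\<close> near \<open>t0\<close>.\<close>
  define lo where "lo = max a (t0 - e/2)"
  define hi where "hi = min b (t0 + e/2)"
  have "lo < hi" using t0(1) e(1) \<open>a < b\<close> by (auto simp: lo_def hi_def)
  then obtain c where c: "c \<in> \<rat>" "lo < c" "c < hi"
    using Rats_dense_in_real by blast
  \<comment> \<open>The first two bounds keep the real segment in \<open>{a..b}\<close>;
    \<open>e/8\<close> keeps the box in the disk, as \<open>2 * r + e/2 < e\<close>.\<close>
  then have "0 < min (c - lo) (min (hi - c) (e/8))" using e(1) by auto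
  then obtain r where r: "r \<in> \<rat>" "0 < r" "r < min (c - lo) (min (hi - c) (e/8))"
    using Rats_dense_in_real by blast
  have ab: "a \<le> c - r" "c + r \<le> b"
    using r(3) by (auto simp: lo_def hi_def)
  have tc: "\<bar>c - t0\<bar> < e/2"
    using c unfolding lo_def hi_def by linarith
  have box: "side_cbox 0 c r \<subseteq> V \<inter> F -` W"
  proof
    fix z assume "z \<in> side_cbox 0 c r"
    then have "norm (z - of_real c) \<le> 2 * r" by (rule side_cbox_norm_le)
    moreover have "norm (z - of_real t0) \<le> norm (z - of_real c) + norm (of_real c - of_real t0 :: complex)"
      using norm_triangle_ineq[of "z - of_real c" "of_real c - of_real t0"] by simp
    moreover have "norm (of_real c - of_real t0 :: complex) = \<bar>c - t0\<bar>"
      by (metis norm_of_real of_real_diff)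
    ultimately have "norm (z - of_real t0) < e" using tc r(3) by linarith
    then show "z \<in> V \<inter> F -` W"
      using e(2) by (auto simp: dist_norm norm_minus_commute)
  qed
  have sub: "side_cbox s c r \<subseteq> side_cbox 0 c r" "side_box s c r \<subseteq> side_cbox 0 c r"
    by (auto simp: side_cbox_def side_box_def)
  have im1: "F ` side_cbox s c r \<subseteq> W \<inter> (curve_img a b \<gamma> \<union> side_domain s V F)"
  proof
    fix w assume "w \<in> F ` side_cbox s c r"
    then obtain z where z: "w = F z" "z \<in> side_cbox s c r" by blast
    then have zV: "z \<in> V" "F z \<in> W" using box sub by auto
    have "F z \<in> curve_img a b \<gamma> \<union> side_domain s V F"
    proof (cases "Im z = 0")
      case True
      then have "z = of_real (Re z)" by (simp add: complex_eq_iff)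
      moreover have "Re z \<in> {a..b}" using z(2) ab by (auto simp: side_cbox_def)
      ultimately have "F z = \<gamma> (Re z)" using F\<gamma> by metis
      then show ?thesis using \<open>Re z \<in> {a..b}\<close> by (simp add: curve_img_def)
    next
      case False
      then have "s = 0 \<or> 0 < s * Im z"
        using z(2) by (auto simp: side_cbox_def less_le)
      then show ?thesis using zV by (auto simp: side_domain_def)
    qed
    then show "w \<in> W \<inter> (curve_img a b \<gamma> \<union> side_domain s V F)" using z zV by auto
  qed
  have im2: "F ` side_box s c r \<subseteq> W \<inter> side_domain s V F"
    using box sub by (force simp: side_domain_def side_box_def)
  have contf: "continuous_on (side_cbox s c r) (\<lambda>z. lam (F z))"
  proof (rule continuous_on_compose2[OF cont _ im1])
    show "continuous_on (side_cbox s c r) F"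
      using box sub holomorphic_on_imp_continuous_on[OF V(2)] by (auto intro: continuous_on_subset)
  qed
  have "(lam \<circ> F) holomorphic_on side_box s c r"
  proof (rule holomorphic_on_compose_gen[OF _ hol im2])
    show "F holomorphic_on side_box s c r"
      using box sub V(2) by (auto intro: holomorphic_on_subset)
  qed
  then have holf: "(\<lambda>z. lam (F z)) holomorphic_on side_box s c r" by (simp add: o_def)
  have "bounded ((\<lambda>z. lam (F z)) ` side_cbox s c r)"
    by (rule compact_imp_bounded[OF compact_continuous_image[OF contf compact_side_cbox]])
  then obtain B where B: "\<And>z. z \<in> side_cbox s c r \<Longrightarrow> norm (lam (F z)) \<le> B"
    by (auto simp: bounded_iff)
  \<comment> \<open>Compactness of the closed box gives the bound \<open>B\<close>, rounded up to a
    natural number to fit \<open>rational_boxes\<close>.\<close>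
  obtain n :: nat where n: "B \<le> real n" using real_arch_simple by blast
  have "side_extension s (u \<circ> \<gamma>) c r (real n) (\<lambda>z. lam (F z))"
    unfolding side_extension_def
  proof (intro conjI contf holf ballI allI impI)
    show "norm (lam (F z)) \<le> real n" if "z \<in> side_cbox s c r" for z
      using B[OF that] n by linarith
    fix t assume t: "\<bar>t - c\<bar> \<le> r"
    then have tab: "t \<in> {a..b}" using ab by auto
    have "of_real t \<in> side_cbox 0 c r" using t r(2) by (auto simp: side_cbox_def)
    then have "F (of_real t) \<in> W" using box by auto
    then have "\<gamma> t \<in> W \<inter> curve_img a b \<gamma>" using tab F\<gamma> by (auto simp: curve_img_def)
    then show "lam (F (of_real t)) = (u \<circ> \<gamma>) t" using eq F\<gamma>[OF tab] by simp
  qed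
  moreover have "(c, r, real n) \<in> rational_boxes a b V"
    using c r ab box by (auto simp: rational_boxes_def)
  ultimately show ?thesis unfolding side_extendable_def by blast
qed

lemma analytic_curve_inverse:
  assumes "analytic_curve_data a b \<gamma> V F"
  obtains g where "g holomorphic_on (F ` V)" "\<And>z. z \<in> V \<Longrightarrow> g (F z) = z"
  using assms holomorphic_has_inverse[of F V] unfolding analytic_curve_data_def by metis

lemma side_extendableE:
  assumes "side_extendable a b V s h"
  obtains c r M f where "0 < r" "a \<le> c - r" "c + r \<le> b" "side_cbox 0 c r \<subseteq> V"
    "side_extension s h c r M f"
  using assms unfolding side_extendable_def rational_boxes_def by blast

text \<open>Injectivity of \<open>F\<close> on all of \<open>V\<close> keeps non-real points of
  \<open>V\<close> off the curve.\<close>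

lemma preimage_curve_img_real:
  assumes F: "analytic_curve_data a b \<gamma> V F"
    and z: "z \<in> V" "F z \<in> curve_img a b \<gamma>"
  shows "\<exists>t\<in>{a..b}. z = of_real t \<and> F z = \<gamma> t"
proof -
  obtain t where t: "t \<in> {a..b}" "F z = \<gamma> t" using z by (auto simp: curve_img_def)
  then have "F z = F (of_real t)" "of_real t \<in> V"
    using F by (auto simp: analytic_curve_data_def)
  then have "z = of_real t"
    using F z(1) unfolding analytic_curve_data_def by (metis inj_onD)
  then show ?thesis using t by blast
qed

text \<open>\<open>W\<close> is the image of the full open box. The definition asks for continuity
  on the whole curve, also outside \<open>W\<close>, so \<open>u\<close> is glued to the transported
  extension along two compact sets, the curve and the image of
  \<open>side_cbox s c r\<close>.\<close>

lemma extends_holo_to_if_side_extendable: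
  assumes F: "analytic_curve_data a b \<gamma> V F" and u: "u \<in> Ck_curve a b \<gamma> k"
    and ext: "side_extendable a b V s (u \<circ> \<gamma>)"
  shows "extends_holo_to (curve_img a b \<gamma>) (side_domain s V F) u"
proof -
  obtain c r M f where r: "0 < r" "a \<le> c - r" "c + r \<le> b" and V: "side_cbox 0 c r \<subseteq> V"
    and f: "side_extension s (u \<circ> \<gamma>) c r M f"
    using ext by (rule side_extendableE)
  obtain g where g: "g holomorphic_on (F ` V)" "\<And>z. z \<in> V \<Longrightarrow> g (F z) = z"
    using analytic_curve_inverse[OF F] by metis
  have F': "open V" "F holomorphic_on V" "inj_on F V" "\<And>t. t \<in> {a..b} \<Longrightarrow> F (of_real t) = \<gamma> t"
    "\<And>t. t \<in> {a..b} \<Longrightarrow> of_real t \<in> V"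
    using F by (auto simp: analytic_curve_data_def)
  have contF: "continuous_on V F" and contg: "continuous_on (F ` V) g"
    using F' g(1) holomorphic_on_imp_continuous_on by blast+
  let ?G = "curve_img a b \<gamma>"
  let ?C = "F ` side_cbox s c r"
  let ?W = "F ` side_box 0 c r"
  define lam where "lam = (\<lambda>z. if z \<in> ?G then u z else f (g z))"
  have boxes: "side_box 0 c r \<subseteq> V" "side_box s c r \<subseteq> V" "side_cbox s c r \<subseteq> V"
    using V by (auto simp: side_cbox_def side_box_def)
  have G_eq: "?G = F ` (of_real ` {a..b})"
    using F'(4) by (auto simp: curve_img_def image_image)
  have rV: "complex_of_real ` {a..b} \<subseteq> V" using F'(5) by auto
  have "compact ?G"
    unfolding G_eq using continuous_on_subset[OF contF rV]
    by (intro compact_continuous_image) (auto intro!: continuous_intros)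
  moreover have "compact ?C"
    using continuous_on_subset[OF contF boxes(3)] compact_side_cbox compact_continuous_image by blast
  moreover have "continuous_on ?G lam"
  proof -
    have "continuous_on {a..b} (u \<circ> \<gamma>)"
      using u by (auto simp: Ck_curve_def Ck_interval_def simp flip: zero_enat_def dest: spec[of _ 0])
    then have "continuous_on ?G (\<lambda>z. (u \<circ> \<gamma>) (Re (g z)))"
    proof (rule continuous_on_compose2)
      have "continuous_on ?G g"
        unfolding G_eq by (rule continuous_on_subset[OF contg]) (use rV in blast)
      then show "continuous_on ?G (\<lambda>z. Re (g z))" by (rule continuous_on_Re)
      show "(\<lambda>z. Re (g z)) ` ?G \<subseteq> {a..b}"
        using F'(5) g(2) by (auto simp: G_eq)
    qed
    moreover have "lam z = (u \<circ> \<gamma>) (Re (g z))" if "z \<in> ?G" for z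
    proof -
      obtain t where t: "t \<in> {a..b}" "z = \<gamma> t" using \<open>z \<in> ?G\<close> by (auto simp: curve_img_def)
      then have "g z = of_real t" using g(2)[OF F'(5)] F'(4) by metis
      then show ?thesis using that t by (simp add: lam_def)
    qed
    ultimately show ?thesis by (simp cong: continuous_on_cong)
  qed
  \<comment> \<open>On the overlap both formulas agree, because there \<open>f\<close> has the
    boundary values \<open>u \<circ> \<gamma>\<close>.\<close>
  moreover have lamC: "lam z = f (g z)" if z: "z \<in> ?C" for z
  proof (cases "z \<in> ?G")
    case True
    obtain q where q: "z = F q" "q \<in> side_cbox s c r" using z by blast
    then obtain t where t: "t \<in> {a..b}" "q = of_real t" "F q = \<gamma> t"
      using preimage_curve_img_real[OF F] boxes True by blast
    then have "\<bar>t - c\<bar> \<le> r" using q by (auto simp: side_cbox_def)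
    then have "f q = u (\<gamma> t)" using f t by (auto simp: side_extension_def)
    then show ?thesis
      using q t True g(2)[of q] boxes by (auto simp: lam_def)
  qed (simp add: lam_def)
  moreover have "continuous_on ?C lam"
  proof -
    have "continuous_on ?C (\<lambda>z. f (g z))"
    proof (rule continuous_on_compose2[of "side_cbox s c r" f])
      show "continuous_on (side_cbox s c r) f" using f by (simp add: side_extension_def)
      show "continuous_on ?C g"
        by (rule continuous_on_subset[OF contg]) (use boxes in blast)
      show "g ` ?C \<subseteq> side_cbox s c r" using g(2) boxes by (auto simp: subset_iff)
    qed
    then show ?thesis using lamC by (simp cong: continuous_on_cong)
  qed
  ultimately have contlam: "continuous_on (?G \<union> ?C) lam"
    by (intro continuous_on_closed_Un compact_imp_closed)
  \<comment> \<open>By injectivity no other part of \<open>V\<close> is mapped into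
    \<open>W\<close>.\<close>
  have WK: "?W \<inter> side_domain s V F = F ` side_box s c r"
  proof
    show "F ` side_box s c r \<subseteq> ?W \<inter> side_domain s V F"
      using boxes by (auto simp: side_domain_def side_box_def)
    show "?W \<inter> side_domain s V F \<subseteq> F ` side_box s c r"
    proof
      fix w assume "w \<in> ?W \<inter> side_domain s V F"
      then obtain p q where "w = F p" "p \<in> side_box 0 c r" "w = F q" "q \<in> V" "s = 0 \<or> 0 < s * Im q"
        unfolding side_domain_def by blast
      moreover then have "p = q" using F'(3) boxes by (meson inj_onD subset_iff)
      ultimately show "w \<in> F ` side_box s c r" by (auto simp: side_box_def)
    qed
  qed
  have lam_hol: "lam holomorphic_on F ` side_box s c r"
  proof -
    have "f \<circ> g holomorphic_on F ` side_box s c r"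
    proof (rule holomorphic_on_compose_gen[where t = "side_box s c r"])
      show "g holomorphic_on F ` side_box s c r"
        by (rule holomorphic_on_subset[OF g(1)]) (use boxes in blast)
      show "f holomorphic_on side_box s c r" using f by (simp add: side_extension_def)
      show "g ` F ` side_box s c r \<subseteq> side_box s c r" using g(2) boxes by (auto simp: subset_iff)
    qed
    moreover have "lam z = (f \<circ> g) z" if "z \<in> F ` side_box s c r" for z
      using that lamC side_box_subset_side_cbox by (metis comp_apply image_mono subset_iff)
    ultimately show ?thesis by (metis holomorphic_transform)
  qed
  have "convex (side_box 0 c r)"
  proof -
    have "side_box 0 c r = box (Complex (c - r) (- r)) (Complex (c + r) r)"
      by (auto simp: side_box_def in_box_complex_iff)
    then show ?thesis by simp
  qed
  then have "connected ?W"
    using continuous_on_subset[OF contF boxes(1)] convex_connected connected_continuous_image by blast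
  moreover have "open ?W"
    using F'(2,3) boxes(1) open_side_box
    by (meson holomorphic_on_subset inj_on_subset open_mapping_thm3)
  moreover have "?W \<inter> ?G \<noteq> {}"
  proof -
    have "c \<in> {a..b}" using r by auto
    moreover have "of_real c \<in> side_box 0 c r" using r by (simp add: side_box_def)
    ultimately show ?thesis using F'(4)[of c] by (auto simp: curve_img_def)
  qed
  moreover have "continuous_on (?G \<union> (?W \<inter> side_domain s V F)) lam"
    unfolding WK by (rule continuous_on_subset[OF contlam]) (use side_box_subset_side_cbox in blast)
  ultimately show ?thesis
    unfolding extends_holo_to_def using lam_hol WK
    by (intro exI[of _ ?W] exI[of _ lam]) (auto simp: lam_def)
qed

lemma extends_holo_to_iff_side_extendable:
  assumes "a < b" "analytic_curve_data a b \<gamma> V F" "u \<in> Ck_curve a b \<gamma> k"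
  shows "extends_holo_to (curve_img a b \<gamma>) (side_domain s V F) u \<longleftrightarrow> side_extendable a b V s (u \<circ> \<gamma>)"
proof
  assume "extends_holo_to (curve_img a b \<gamma>) (side_domain s V F) u"
  then obtain W lam where W: "open W" "W \<inter> curve_img a b \<gamma> \<noteq> {}"
    and cont: "continuous_on (curve_img a b \<gamma> \<union> (W \<inter> side_domain s V F)) lam"
    and hol: "lam holomorphic_on (W \<inter> side_domain s V F)"
    and eq: "\<forall>z\<in>W \<inter> curve_img a b \<gamma>. lam z = u z"
    unfolding extends_holo_to_def by blast
  have "continuous_on (W \<inter> (curve_img a b \<gamma> \<union> side_domain s V F)) lam"
    by (rule continuous_on_subset[OF cont]) blast
  then show "side_extendable a b V s (u \<circ> \<gamma>)"
    using side_extendable_if_local_extension[OF assms(1,2) W _ hol] eq by blast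
qed (use extends_holo_to_if_side_extendable assms in blast)

text \<open>The case \<open>s = 0\<close>. Conversely \<open>F\<close> is an open map, so the image
  of the open box contains a disk around \<open>\<gamma> c\<close>, on which \<open>f\<close>
  composed with the inverse of \<open>F\<close> is the required function.\<close>

lemma locally_holomorphic_iff_side_extendable:
  assumes "a < b" and F: "analytic_curve_data a b \<gamma> V F"
  shows "(\<exists>z0\<in>curve_img a b \<gamma>. \<exists>r>0. \<exists>f. f holomorphic_on ball z0 r \<and>
      (\<forall>z\<in>ball z0 r \<inter> curve_img a b \<gamma>. f z = u z)) \<longleftrightarrow> side_extendable a b V 0 (u \<circ> \<gamma>)"
    (is "?L \<longleftrightarrow> ?R")
proof
  assume ?L
  then obtain z0 r f where z0: "z0 \<in> curve_img a b \<gamma>" "r > 0" and f: "f holomorphic_on ball z0 r"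
    "\<forall>z\<in>ball z0 r \<inter> curve_img a b \<gamma>. f z = u z" by blast
  show ?R
  proof (rule side_extendable_if_local_extension[OF assms, where W = "ball z0 r" and lam = f])
    show "ball z0 r \<inter> curve_img a b \<gamma> \<noteq> {}" using z0 centre_in_ball by blast
    show "f holomorphic_on ball z0 r \<inter> side_domain 0 V F"
      using f(1) by (rule holomorphic_on_subset) blast
    show "continuous_on (ball z0 r \<inter> (curve_img a b \<gamma> \<union> side_domain 0 V F)) f"
      using holomorphic_on_imp_continuous_on[OF f(1)] by (rule continuous_on_subset) blast
  qed (use f in auto)
next
  assume ?R
  then obtain c r M f where r: "0 < r" "a \<le> c - r" "c + r \<le> b" and V: "side_cbox 0 c r \<subseteq> V"
    and f: "side_extension 0 (u \<circ> \<gamma>) c r M f"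
    by (rule side_extendableE)
  obtain g where g: "g holomorphic_on (F ` V)" "\<And>z. z \<in> V \<Longrightarrow> g (F z) = z"
    using analytic_curve_inverse[OF F] by metis
  have F': "F holomorphic_on V" "inj_on F V" "\<And>t. t \<in> {a..b} \<Longrightarrow> F (of_real t) = \<gamma> t"
    using F by (auto simp: analytic_curve_data_def)
  let ?W = "F ` side_box 0 c r"
  have box: "side_box 0 c r \<subseteq> V" using V side_box_subset_side_cbox by blast
  have "open ?W"
    using F' box open_side_box by (meson holomorphic_on_subset inj_on_subset open_mapping_thm3)
  moreover have c: "c \<in> {a..b}" using r by auto
  moreover have "\<gamma> c \<in> ?W"
    unfolding F'(3)[OF c, symmetric] using r by (intro imageI) (simp add: side_box_def)
  ultimately obtain d where d: "d > 0" "ball (\<gamma> c) d \<subseteq> ?W"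
    by (meson open_contains_ball)
  have "f \<circ> g holomorphic_on ?W"
  proof (rule holomorphic_on_compose_gen[where t = "side_box 0 c r"])
    show "g holomorphic_on ?W" by (rule holomorphic_on_subset[OF g(1)]) (use box in blast)
    show "f holomorphic_on side_box 0 c r" using f by (simp add: side_extension_def)
    show "g ` ?W \<subseteq> side_box 0 c r" using g(2) box by (auto simp: subset_iff)
  qed
  then have "f \<circ> g holomorphic_on ball (\<gamma> c) d" using d(2) by (rule holomorphic_on_subset)
  moreover have "(f \<circ> g) z = u z" if z: "z \<in> ball (\<gamma> c) d \<inter> curve_img a b \<gamma>" for z
  proof -
    obtain q where q: "z = F q" "q \<in> side_box 0 c r" using z d(2) by blast
    then obtain t where t: "t \<in> {a..b}" "q = of_real t" "F q = \<gamma> t"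
      using preimage_curve_img_real[OF F] box z by blast
    then have "\<bar>t - c\<bar> \<le> r" using q by (auto simp: side_box_def)
    then have "f q = u (\<gamma> t)" using f t by (auto simp: side_extension_def)
    then show ?thesis using q t g(2)[of q] box by auto
  qed
  moreover have "\<gamma> c \<in> curve_img a b \<gamma>" using c by (simp add: curve_img_def)
  ultimately show ?L using d(1) by blast
qed

section \<open>Genericity\<close>

text \<open>Taking closures only shrinks the box by the factor 8, and the smaller box is again
  rational. Hence closures add nothing to the union over all boxes.\<close>

lemma closure_of_side_extensions:
  assumes "a < b" and s: "s = 0 \<or> s = 1 \<or> s = -1"
    and box: "(c, r, M) \<in> rational_boxes a b V"
    and u: "u \<in> ck_topology a b \<gamma> k closure_of {u \<in> Ck_curve a b \<gamma> k. \<exists>f. side_extension s (u \<circ> \<gamma>) c r M f}"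
  shows "side_extendable a b V s (u \<circ> \<gamma>)"
proof -
  have uC: "u \<in> Ck_curve a b \<gamma> k"
    using u topspace_ck_topology[OF \<open>a < b\<close>] by (auto simp: in_closure_of)
  have r: "r \<in> \<rat>" "0 < r" "a \<le> c - r" "c + r \<le> b" "side_cbox 0 c r \<subseteq> V" "c \<in> \<rat>" "M \<in> \<nat>"
    using box by (auto simp: rational_boxes_def)
  have "\<exists>v f. v \<in> Ck_curve a b \<gamma> k \<and> side_extension s (v \<circ> \<gamma>) c r M f \<and>
      ck_seminorm a b \<gamma> 0 (\<lambda>z. v z - u z) < inverse (real (Suc n))" for n
  proof -
    let ?B = "{v \<in> Ck_curve a b \<gamma> k. ck_seminorm a b \<gamma> 0 (\<lambda>z. v z - u z) < inverse (real (Suc n))}"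
    have "openin (ck_topology a b \<gamma> k) ?B"
      by (rule openin_ck_topology_sup_ball[OF uC]) simp
    moreover have "u \<in> ?B"
      using uC ck_seminorm_zero_diff[OF \<open>a < b\<close>, of \<gamma> u] by simp
    ultimately have "\<exists>v. v \<in> {u \<in> Ck_curve a b \<gamma> k. \<exists>f. side_extension s (u \<circ> \<gamma>) c r M f} \<and> v \<in> ?B"
      using u[unfolded in_closure_of] by (elim conjE allE[of _ ?B] impE) (intro conjI)
    then show ?thesis by blast
  qed
  then obtain v f where v: "\<And>n. v n \<in> Ck_curve a b \<gamma> k"
    "\<And>n. side_extension s (v n \<circ> \<gamma>) c r M (f n)"
    "\<And>n. ck_seminorm a b \<gamma> 0 (\<lambda>z. v n z - u z) < inverse (real (Suc n))"
    by metis
  have "\<exists>g. side_extension s (u \<circ> \<gamma>) c (r/8) M g"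
  proof (rule side_extension_limit[OF r(2) s v(2)])
    fix n t assume t: "\<bar>t - c\<bar> \<le> r"
    then have "t \<in> {a..b}" using r by auto
    then have "norm (iter_deriv a b 0 ((\<lambda>z. v n z - u z) \<circ> \<gamma>) t) \<le> ck_seminorm a b \<gamma> 0 (\<lambda>z. v n z - u z)"
      by (intro norm_iter_deriv_le_ck_seminorm[OF Ck_curve_diff[OF \<open>a < b\<close> v(1) uC]])
         (simp_all flip: zero_enat_def)
    then show "norm ((v n \<circ> \<gamma>) t - (u \<circ> \<gamma>) t) \<le> inverse (real (Suc n))"
      using v(3)[of n] by simp
  qed
  moreover have "side_cbox 0 c (r/8) \<subseteq> side_cbox 0 c r"
    using r(2) by (auto simp: side_cbox_def)
  then have "(c, r/8, M) \<in> rational_boxes a b V"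
    using r by (auto simp: rational_boxes_def)
  ultimately show ?thesis unfolding side_extendable_def by blast
qed

text \<open>The complement is a countable union of closures, hence an F-sigma set.\<close>

lemma gdelta_in_not_side_extendable:
  assumes "a < b" and s: "s = 0 \<or> s = 1 \<or> s = -1"
  shows "gdelta_in (ck_topology a b \<gamma> k) {u \<in> Ck_curve a b \<gamma> k. \<not> side_extendable a b V s (u \<circ> \<gamma>)}"
proof -
  let ?X = "ck_topology a b \<gamma> k"
  define A where "A = (\<lambda>(c, r, M). {u \<in> Ck_curve a b \<gamma> k. \<exists>f. side_extension s (u \<circ> \<gamma>) c r M f})"
  let ?U = "\<Union>((\<lambda>i. ?X closure_of A i) ` rational_boxes a b V)"
  have "fsigma_in ?X ?U"
    using countable_rational_boxes
    by (intro fsigma_in_Union) (auto intro: closed_imp_fsigma_in)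
  then have "gdelta_in ?X (topspace ?X - ?U)"
    by (intro gdelta_in_diff gdelta_in_topspace)
  moreover have "topspace ?X - ?U = {u \<in> Ck_curve a b \<gamma> k. \<not> side_extendable a b V s (u \<circ> \<gamma>)}"
  proof -
    have "u \<in> ?U \<longleftrightarrow> side_extendable a b V s (u \<circ> \<gamma>)" if u: "u \<in> Ck_curve a b \<gamma> k" for u
    proof
      assume "u \<in> ?U"
      then show "side_extendable a b V s (u \<circ> \<gamma>)"
        using closure_of_side_extensions[OF assms] by (auto simp: A_def)
    next
      assume "side_extendable a b V s (u \<circ> \<gamma>)"
      then obtain i where i: "i \<in> rational_boxes a b V" "u \<in> A i"
        using u unfolding side_extendable_def A_def by blast
      have "A i \<subseteq> topspace ?X"
        unfolding topspace_ck_topology[OF \<open>a < b\<close>] by (auto simp: A_def split: prod.splits)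
      then show "u \<in> ?U" using i closure_of_subset by blast
    qed
    then show ?thesis unfolding topspace_ck_topology[OF \<open>a < b\<close>] by blast
  qed
  ultimately show ?thesis by simp
qed

text \<open>Both sides are excluded at once, so this one dense set serves all four classes.\<close>

lemma dense_not_side_extendable:
  assumes "a < b" "inj_on \<gamma> {a..b}"
  shows "ck_topology a b \<gamma> k closure_of
      {u \<in> Ck_curve a b \<gamma> k. \<not> side_extendable a b V 1 (u \<circ> \<gamma>) \<and> \<not> side_extendable a b V (-1) (u \<circ> \<gamma>)}
    = topspace (ck_topology a b \<gamma> k)"
    (is "?X closure_of ?D = _")
proof -
  obtain v where v: "v \<in> Ck_curve a b \<gamma> k" "\<And>t. t \<in> {a..b} \<Longrightarrow> v (\<gamma> t) = of_real (lacunary_cos 0 t)"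
    using lacunary_curve_function[OF assms] by metis
  have meets: "\<exists>y. y \<in> ?D \<and> y \<in> T" if T: "openin ?X T" "u \<in> T" for u T
  proof (rule ccontr)
    assume contra: "\<not> (\<exists>y. y \<in> ?D \<and> y \<in> T)"
    define w where "w = (\<lambda>x::real. \<lambda>z. u z + of_real x * v z)"
    obtain e where e: "e > 0" "\<And>x::real. \<bar>x\<bar> < e \<Longrightarrow> w x \<in> T"
      using openin_ck_topology_line[OF \<open>a < b\<close> v(1) T] unfolding w_def by blast
    have TC: "T \<subseteq> Ck_curve a b \<gamma> k"
      using openin_subset[OF T(1)] topspace_ck_topology[OF \<open>a < b\<close>] by simp
    have "\<exists>s i. s \<in> {1, -1} \<and> i \<in> rational_boxes a b V \<and>
        (\<exists>f. side_extension s (w x \<circ> \<gamma>) (fst i) (fst (snd i)) (snd (snd i)) f)"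
      if "x \<in> {0<..<e}" for x
    proof -
      have "w x \<in> T" using e(2) that by auto
      then have "side_extendable a b V 1 (w x \<circ> \<gamma>) \<or> side_extendable a b V (-1) (w x \<circ> \<gamma>)"
        using contra TC by blast
      then show ?thesis unfolding side_extendable_def by fastforce
    qed
    then obtain s i where si: "\<And>x. x \<in> {0<..<e} \<Longrightarrow> s x \<in> {1, -1::real} \<and> i x \<in> rational_boxes a b V \<and>
        (\<exists>f. side_extension (s x) (w x \<circ> \<gamma>) (fst (i x)) (fst (snd (i x))) (snd (snd (i x))) f)"
      by metis
    \<comment> \<open>Pigeonhole: uncountably many parameters, countably many pairs of side and
      box.\<close>
    have "\<not> inj_on (\<lambda>x. (s x, i x)) {0<..<e}"
    proof
      assume inj: "inj_on (\<lambda>x. (s x, i x)) {0<..<e}"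
      have "(\<lambda>x. (s x, i x)) ` {0<..<e} \<subseteq> {1, -1} \<times> rational_boxes a b V"
        using si by (intro image_subsetI) blast
      moreover have "countable ({1, -1::real} \<times> rational_boxes a b V)"
        using countable_rational_boxes by (intro countable_SIGMA) auto
      ultimately have "countable {0<..<e}"
        using countable_image_inj_on[OF countable_subset inj] by blast
      then show False using uncountable_open_interval[of 0 e] e(1) by simp
    qed
    then obtain x y where xy: "x \<in> {0<..<e}" "y \<in> {0<..<e}" "x \<noteq> y" "s x = s y" "i x = i y"
      unfolding inj_on_def by blast
    obtain c r M where i: "i x = (c, r, M)" by (cases "i x")
    have box: "0 < r" "a \<le> c - r" "c + r \<le> b" and s: "s x = 1 \<or> s x = -1"
      using si[OF xy(1)] i by (auto simp: rational_boxes_def)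
    obtain f1 f2 where f: "side_extension (s x) (w x \<circ> \<gamma>) c r M f1" "side_extension (s x) (w y \<circ> \<gamma>) c r M f2"
      using si[OF xy(1)] si[OF xy(2)] i xy by auto
    \<comment> \<open>The difference of the two functions is \<open>(x - y) * v\<close>, and
      \<open>q\<close> rescales it to \<open>v\<close>.\<close>
    define q :: complex where "q = inverse (of_real (x - y))"
    have "side_extension (s x) (\<lambda>t. of_real (lacunary_cos 0 t)) c r (norm q * (2 * M)) (\<lambda>z. q * (f1 z - f2 z))"
    proof (rule side_extension_cong[OF side_extension_cmult[OF side_extension_diff[OF f]]])
      fix t assume "\<bar>t - c\<bar> \<le> r"
      then have t: "t \<in> {a..b}" using box by auto
      have "(w x \<circ> \<gamma>) t - (w y \<circ> \<gamma>) t = of_real (x - y) * of_real (lacunary_cos 0 t)"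
        using v(2)[OF t] by (simp add: w_def algebra_simps)
      then show "q * ((w x \<circ> \<gamma>) t - (w y \<circ> \<gamma>) t) = of_real (lacunary_cos 0 t)"
        using xy(3) by (simp add: q_def del: of_real_diff)
    qed
    then show False using lacunary_cos_no_side_extension[OF box(1) s] by blast
  qed
  have "u \<in> ?X closure_of ?D" if "u \<in> topspace ?X" for u
    unfolding in_closure_of using that
    by (intro conjI allI impI) (assumption, elim conjE, rule meets)
  then have "topspace ?X \<subseteq> ?X closure_of ?D" by (rule subsetI)
  then show ?thesis by (rule subset_antisym[OF closure_of_subset_topspace])
qed

lemma dense_gdelta_in_superset:
  assumes "X closure_of D = topspace X" "D \<subseteq> S" "gdelta_in X S"
  shows "dense_gdelta_in X S"
  using assms closure_of_mono[OF assms(2), of X] closure_of_subset_topspace[of X S]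
  unfolding dense_gdelta_in_def by auto

theorem theorem4p35:
  fixes a b :: real and \<gamma> :: "real \<Rightarrow> complex" and V :: "complex set"
    and F :: "complex \<Rightarrow> complex" and k :: enat
  assumes "a < b"
    and "inj_on \<gamma> {a..b}"
    and "analytic_curve_data a b \<gamma> V F"
  shows "dense_gdelta_in (ck_topology a b \<gamma> k) (U2 a b \<gamma> V F k)
       \<and> dense_gdelta_in (ck_topology a b \<gamma> k) (U3 a b \<gamma> V F k)
       \<and> dense_gdelta_in (ck_topology a b \<gamma> k) (U4 a b \<gamma> V F k)
       \<and> dense_gdelta_in (ck_topology a b \<gamma> k) (U5 a b \<gamma> k)"
proof -
  let ?N = "\<lambda>s. {u \<in> Ck_curve a b \<gamma> k. \<not> side_extendable a b V s (u \<circ> \<gamma>)}"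
  have U2: "U2 a b \<gamma> V F k = ?N 1" and U3: "U3 a b \<gamma> V F k = ?N (-1)"
    using extends_holo_to_iff_side_extendable[OF assms(1,3)]
    unfolding U2_def U3_def K_plus_eq_side_domain K_minus_eq_side_domain by blast+
  have U5: "U5 a b \<gamma> k = ?N 0"
    unfolding U5_def locally_holomorphic_iff_side_extendable[OF assms(1,3)] ..
  \<comment> \<open>An extension to the whole box restricts to a half box, so the dense set also
    lies in the class \<open>U5\<close>.\<close>
  have "side_extendable a b V 1 h" if "side_extendable a b V 0 h" for h
    using that side_extension_bilateral_imp_unilateral unfolding side_extendable_def by blast
  then have sub: "?N 1 \<inter> ?N (-1) \<subseteq> ?N s" if "s \<in> {0, 1, -1}" for s
    using that by auto
  have "?N 1 \<inter> ?N (-1) = {u \<in> Ck_curve a b \<gamma> k.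
      \<not> side_extendable a b V 1 (u \<circ> \<gamma>) \<and> \<not> side_extendable a b V (-1) (u \<circ> \<gamma>)}" by blast
  then have dense: "ck_topology a b \<gamma> k closure_of (?N 1 \<inter> ?N (-1)) = topspace (ck_topology a b \<gamma> k)"
    using dense_not_side_extendable[OF assms(1,2)] by simp
  have gd: "gdelta_in (ck_topology a b \<gamma> k) (?N s)" if "s \<in> {0, 1, -1}" for s
    using that gdelta_in_not_side_extendable[OF assms(1)] by simp
  have "dense_gdelta_in (ck_topology a b \<gamma> k) (?N s)" if "s \<in> {0, 1, -1}" for s
    by (rule dense_gdelta_in_superset[OF dense sub[OF that] gd[OF that]])
  moreover have "dense_gdelta_in (ck_topology a b \<gamma> k) (?N 1 \<inter> ?N (-1))"
    by (rule dense_gdelta_in_superset[OF dense order_refl gdelta_in_Int[OF gd gd]]) auto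
  ultimately show ?thesis
    unfolding U4_def U2 U3 U5 by simp
qed

end
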